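(* Let $E$ be an infinite dimensional real reflexive Banach space compactly embedded into another reflexive Banach space $Z$. Let $\Phi:E\to\mathbb{R}$ and $H:Z\to\mathbb{R}$ be Fréchet differentiable convex functionals with derivatives $\varphi:E\to E^{*}$ and $h:Z\to Z^{*}$ respectively, and suppose there exist constants $\alpha>1$, $\gamma>0$ such that $$\gamma\|v\|^{\alpha}\le\langle\varphi(v),v\rangle_{E^{*},E}\quad\text{for all }v\in E.$$ For $\lambda>0$ let $J:E\to\mathbb{R}$, $J(x)=\Phi(x)-\lambda H(x)$. Take any $\rho>0$. (i) Assume that the functional $x\mapsto\|h(x)\|_{Z^{*}}$ is bounded from above on $B_{\rho}$. Then there exists $\lambda^{*}>0$ such that for each $\lambda\in(0,\lambda^{*}]$ there exists $u\in B_{\rho}$ with $$J(u)=\inf_{x\in B_{\rho}}J(x)$$ and such that $u$ is a critical point of $J$, and thus it solves $\varphi(u)=\lambda h(u)$. If for some $v\in B_{\rho}$ it holds that $J(v)<0$, and $J(0)=0$, then $u$ is non-trivial (i.e. $u\neq0$). (ii) Assume additionally that for all $\lambda\in(0,\lambda^{*}]$ (with $u$ the corresponding point from (i)): (a) $J$ satisfies the Palais–Smale condition; (b) $J(u)<\inf_{x\in\partial B_{\rho_{1}}}J(x)$ for some $\rho_{1}>\|u\|$; (c) there exists $w\in E$ with $\lim_{t\to\infty}J(tw)=-\infty$. Then for all $\lambda\in(0,\lambda^{*}]$ the functional $J$ has two critical points, namely $u$ and another non-zero critical point $z$ different from $u$.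
   Context: $B_{\rho}\subset E$ denotes the closed ball centered at $0$ in $E$ with radius $\rho$, and $\partial B_{\rho}$ its boundary sphere. Elements of $E$ are regarded as elements of $Z$ via the embedding $E\subset Z$, and $h(u)\in Z^{*}$ is regarded as an element of $E^{*}$ by restriction, so that $\varphi(u)=\lambda h(u)$ means $\langle\varphi(u),x\rangle_{E^{*},E}=\lambda\langle h(u),x\rangle_{Z^{*},Z}$ for all $x\in E$. A critical point of $J$ is a point at which the derivative of $J$ on $E$ vanishes. $J:E\to\mathbb{R}$ satisfies the Palais–Smale condition if every sequence $(u_{n})$ in $E$ such that $\{J(u_{n})\}$ is bounded and $J'(u_{n})\to0$ has a convergent subsequence. *)

theory Defs
  imports "HOL-Analysis.Analysis"
begin

definition reflexive_space :: "'a::real_normed_vector itself \<Rightarrow> bool" where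
  "reflexive_space _ \<longleftrightarrow>
     (\<forall>F :: ('a \<Rightarrow>\<^sub>L real) \<Rightarrow>\<^sub>L real. \<exists>x. \<forall>f. blinfun_apply F f = blinfun_apply f x)"

definition infinite_dimensional :: "'a::real_vector itself \<Rightarrow> bool" where
  "infinite_dimensional _ \<longleftrightarrow> (\<nexists>B :: 'a set. finite B \<and> span B = UNIV)"

definition compact_embedding :: "('a::real_normed_vector \<Rightarrow> 'b::real_normed_vector) \<Rightarrow> bool" where
  "compact_embedding i \<longleftrightarrow>
     bounded_linear i \<and> inj i \<and> (\<forall>S. bounded S \<longrightarrow> compact (closure (i ` S)))"

definition critical_point :: "('a::real_normed_vector \<Rightarrow> real) \<Rightarrow> 'a \<Rightarrow> bool" where
  "critical_point J u \<longleftrightarrow> (J has_derivative (\<lambda>_. 0)) (at u)"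

text \<open>The derivatives \<open>D n\<close> are elements of the dual space, so their convergence to \<open>0\<close> is
  in the dual norm.\<close>

definition palais_smale :: "('a::real_normed_vector \<Rightarrow> real) \<Rightarrow> bool" where
  "palais_smale J \<longleftrightarrow>
     (\<forall>(u :: nat \<Rightarrow> 'a) (D :: nat \<Rightarrow> 'a \<Rightarrow>\<^sub>L real).
        bounded (range (\<lambda>n. J (u n))) \<and>
        (\<forall>n. (J has_derivative blinfun_apply (D n)) (at (u n))) \<and>
        D \<longlonglongrightarrow> 0 \<longrightarrow>
        (\<exists>(r :: nat \<Rightarrow> nat) l. strict_mono r \<and> (u \<circ> r) \<longlonglongrightarrow> l))"

text \<open>Infima are taken in \<open>ereal\<close>, because on \<open>real\<close> the infimum of a set that is unbounded below
  is an unspecified number.\<close>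

definition ball_minimizer :: "('a::real_normed_vector \<Rightarrow> real) \<Rightarrow> real \<Rightarrow> 'a \<Rightarrow> bool" where
  "ball_minimizer J \<rho> u \<longleftrightarrow>
     u \<in> cball 0 \<rho> \<and> ereal (J u) = (INF x\<in>cball 0 \<rho>. ereal (J x))"

end

theory Submission
  imports Defs
begin

text \<open>Everything rests on choosing \<open>\<lambda>\<^sup>*\<close> so small that the sphere of radius \<open>\<rho>\<close> is a mountain range
  for \<open>J\<close> which surrounds \<open>0\<close>.  Coercivity and convexity force \<open>\<Phi>\<close> to grow by at least
  \<open>c = \<gamma> (\<rho> / 2)\<^sup>\<alpha>\<close> between \<open>0\<close> and the sphere (\<open>convex_coercive_growth\<close>), while the bound on \<open>h\<close>
  lets \<open>H\<close> grow by at most a constant \<open>K\<close> on the ball.  With \<open>\<lambda> K \<le> c / 2\<close> one gets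
  \<open>J \<ge> J 0 + c / 2\<close> on the sphere and \<open>J \<ge> J 0 - c / 2\<close> in the ball.

  A minimizer of \<open>J\<close> over the ball therefore cannot lie on the sphere, so it is an interior
  minimum and hence critical.  Existence of a minimizer is \<open>convex_plus_compact_attains_min\<close>: along a
  minimizing sequence the images in \<open>Z\<close> converge to some \<open>y\<close> after passing to a subsequence, and the
  points of the ball whose image is near \<open>y\<close> and whose \<open>\<Phi>\<close>-value is nearly optimal
  form a decreasing sequence of closed convex sets.  In a reflexive space such a sequence has a
  common point (\<open>reflexive_nested_convex_Inter\<close>), which comes from the Hahn--Banach theorem alone;
  weak topologies do not appear.

  For the second critical point, the condition along the ray \<open>t w\<close> yields a point beyond the sphere
  where \<open>J\<close> is below \<open>J 0\<close>.  The theorem \<open>mountain_pass\<close>, applied to this point, to \<open>0\<close> and to the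
  sphere of radius \<open>\<rho>\<close>, gives a critical point \<open>z\<close> with \<open>J z \<ge> J 0 + c / 2\<close>.  Since
  \<open>J u \<le> J 0\<close>, this single estimate separates \<open>z\<close> both from \<open>u\<close> and from \<open>0\<close>.

  The mountain pass theorem needs a continuous derivative.  It is available because an everywhere
  Frechet differentiable convex function is automatically continuously differentiable
  (\<open>convex_has_derivative_continuous\<close>).  The mountain pass point itself comes from
  Ekeland's variational principle for the peak height of \<open>J\<close> along a path, on the complete metric space of paths.\<close>

section \<open>Sublinear functionals and the Hahn--Banach theorem\<close>

text \<open>For \<open>t > 0\<close> the reverse inequality in the second clause follows by scaling with \<open>1 / t\<close>.\<close>
definition sublinear :: "('a::real_vector \<Rightarrow> real) \<Rightarrow> bool" where
  "sublinear p \<longleftrightarrow> (\<forall>x y. p (x + y) \<le> p x + p y) \<and> (\<forall>t\<ge>0. \<forall>x. p (t *\<^sub>R x) \<le> t * p x)"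

lemma sublinear_add: "sublinear p \<Longrightarrow> p (x + y) \<le> p x + p y"
  and sublinear_scale_le: "sublinear p \<Longrightarrow> 0 \<le> t \<Longrightarrow> p (t *\<^sub>R x) \<le> t * p x"
  by (auto simp: sublinear_def)

lemma sublinear_0: "sublinear p \<Longrightarrow> p 0 = 0"
  using sublinear_add[of p 0 0] sublinear_scale_le[of p 0 0] by simp

lemma sublinear_scale:
  assumes "sublinear p" "0 \<le> t"
  shows "p (t *\<^sub>R x) = t * p x"
proof (cases "t = 0")
  case True
  then show ?thesis using sublinear_0[OF assms(1)] by simp
next
  case False
  with assms(2) have t: "t > 0" by simp
  have "p x \<le> inverse t * p (t *\<^sub>R x)"
    using sublinear_scale_le[OF assms(1), of "inverse t" "t *\<^sub>R x"] t by simp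
  then have "t * p x \<le> p (t *\<^sub>R x)" using t by (simp add: field_simps)
  then show ?thesis using sublinear_scale_le[OF assms, of x] by simp
qed

lemma sublinear_ge_minus: "sublinear p \<Longrightarrow> - p (- x) \<le> p x"
  using sublinear_add[of p x "- x"] sublinear_0[of p] by simp

text \<open>The infimum \<open>q y = inf {p (y + t c) - t d | t \<ge> 0, c \<in> D}\<close> is the largest sublinear functional
  below \<open>p\<close> that is at most \<open>-d\<close> on \<open>-D\<close>; convexity of \<open>D\<close> makes it subadditive.  The construction
  is used twice: with \<open>D\<close> a single point it shows that minimal sublinear functionals are
  linear, and with \<open>p\<close> the norm and \<open>D\<close> a translated convex set it yields separation.\<close>
lemma sublinear_lowered_on_convex:
  fixes p :: "'a::real_vector \<Rightarrow> real"
  assumes p: "sublinear p" and D: "convex D" "D \<noteq> {}" and d: "\<And>c. c \<in> D \<Longrightarrow> d \<le> p c"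
  obtains q where "sublinear q" "\<And>x. q x \<le> p x" "\<And>c. c \<in> D \<Longrightarrow> q (- c) \<le> - d"
proof -
  define S where "S y = (\<lambda>(t, c). p (y + t *\<^sub>R c) - t * d) ` ({0..} \<times> D)" for y
  define q where "q y = Inf (S y)" for y
  have lower: "- p (- y) \<le> p (y + t *\<^sub>R c) - t * d" if "0 \<le> t" "c \<in> D" for y t c
  proof -
    have "t * d \<le> p (t *\<^sub>R c)"
      using d[OF that(2)] that(1) by (simp add: sublinear_scale[OF p] mult_left_mono)
    also have "\<dots> \<le> p (y + t *\<^sub>R c) + p (- y)"
      using sublinear_add[OF p, of "y + t *\<^sub>R c" "- y"] by simp
    finally show ?thesis by simp
  qed
  have bdd: "bdd_below (S y)" for y
    using lower by (intro bdd_belowI[of _ "- p (- y)"]) (auto simp: S_def)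
  have ne: "S y \<noteq> {}" for y using D(2) by (auto simp: S_def)
  have q_le: "q y \<le> p (y + t *\<^sub>R c) - t * d" if "0 \<le> t" "c \<in> D" for y t c
    unfolding q_def using that by (intro cInf_lower[OF _ bdd]) (auto simp: S_def)
  have q_ge: "b \<le> q y" if "\<And>t c. 0 \<le> t \<Longrightarrow> c \<in> D \<Longrightarrow> b \<le> p (y + t *\<^sub>R c) - t * d" for y b
    unfolding q_def using that by (intro cInf_greatest[OF ne]) (auto simp: S_def)
  have q_le_p: "q y \<le> p y" for y
    using D(2) q_le[of 0 _ y] by auto
  have q_add: "q (x + y) \<le> q x + q y" for x y
  proof -
    have *: "q (x + y) \<le> (p (x + s *\<^sub>R b) - s * d) + (p (y + t *\<^sub>R c) - t * d)"
      if "0 \<le> s" "b \<in> D" "0 \<le> t" "c \<in> D" for s b t c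
    proof -
      have "\<exists>e\<in>D. s *\<^sub>R b + t *\<^sub>R c = (s + t) *\<^sub>R e"
      proof (cases "s = 0 \<and> t = 0")
        case True
        then show ?thesis using that(2) by auto
      next
        case False
        then have pos: "s + t > 0" using that by auto
        have "(s / (s + t)) *\<^sub>R b + (t / (s + t)) *\<^sub>R c \<in> D"
          using that pos by (intro convexD[OF D(1)]) (auto simp: add_divide_distrib[symmetric])
        moreover have "s *\<^sub>R b + t *\<^sub>R c = (s + t) *\<^sub>R ((s / (s + t)) *\<^sub>R b + (t / (s + t)) *\<^sub>R c)"
          using pos by (simp add: scaleR_add_right)
        ultimately show ?thesis by blast
      qed
      then obtain e where e: "e \<in> D" "s *\<^sub>R b + t *\<^sub>R c = (s + t) *\<^sub>R e" by blast
      have "q (x + y) \<le> p ((x + s *\<^sub>R b) + (y + t *\<^sub>R c)) - (s + t) * d"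
        using q_le[of "s + t" e "x + y"] e that by (simp add: algebra_simps)
      also have "\<dots> \<le> p (x + s *\<^sub>R b) + p (y + t *\<^sub>R c) - (s + t) * d"
        using sublinear_add[OF p] by simp
      finally show ?thesis by (simp add: algebra_simps)
    qed
    have "q (x + y) - (p (y + t *\<^sub>R c) - t * d) \<le> q x" if "0 \<le> t" "c \<in> D" for t c
    proof (rule q_ge)
      fix s :: real and b :: 'a assume "0 \<le> s" "b \<in> D"
      then show "q (x + y) - (p (y + t *\<^sub>R c) - t * d) \<le> p (x + s *\<^sub>R b) - s * d"
        using *[of s b t c] that by linarith
    qed
    then have "q (x + y) - q x \<le> q y"
      by (intro q_ge) (simp add: algebra_simps)
    then show ?thesis by simp
  qed
  have q_scale: "q (t *\<^sub>R x) \<le> t * q x" if t: "0 \<le> t" for t x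
  proof (cases "t = 0")
    case True
    then show ?thesis using q_le_p[of 0] sublinear_0[OF p] by simp
  next
    case False
    with t have t: "t > 0" by simp
    have "q (t *\<^sub>R x) / t \<le> q x"
    proof (rule q_ge)
      fix s :: real and c assume s: "0 \<le> s" "c \<in> D"
      have "q (t *\<^sub>R x) \<le> p (t *\<^sub>R (x + s *\<^sub>R c)) - (t * s) * d"
        using q_le[of "t * s" c "t *\<^sub>R x"] s t by (simp add: scaleR_add_right)
      also have "\<dots> = t * (p (x + s *\<^sub>R c) - s * d)"
        using sublinear_scale[OF p, of t "x + s *\<^sub>R c"] t by (simp add: right_diff_distrib)
      finally show "q (t *\<^sub>R x) / t \<le> p (x + s *\<^sub>R c) - s * d"
        using t by (simp add: field_simps)
    qed
    then show ?thesis using t by (simp add: field_simps)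
  qed
  show ?thesis
  proof
    show "sublinear q" using q_add q_scale by (auto simp: sublinear_def)
    show "q x \<le> p x" for x by (rule q_le_p)
    show "q (- c) \<le> - d" if "c \<in> D" for c
      using q_le[of 1 c "- c"] that sublinear_0[OF p] by simp
  qed
qed

text \<open>By Zorn's lemma there is a minimal sublinear functional \<open>m\<close> below \<open>p\<close>.  Lowering \<open>m\<close> at a point
  \<open>x\<close> as above changes nothing, by minimality, and this says \<open>m (- x) \<le> - m x\<close>.  An odd
  sublinear functional is linear.\<close>
theorem sublinear_dominates_linear:
  fixes p :: "'a::real_vector \<Rightarrow> real"
  assumes p: "sublinear p"
  obtains f where "linear f" "\<And>x. f x \<le> p x"
proof -
  define A where "A = {q. sublinear q \<and> q \<le> p}"
  have "\<exists>m\<in>A. \<forall>a\<in>A. m \<ge> a \<longrightarrow> a = m"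
  proof (rule predicate_Zorn)
    show "partial_order_on A (relation_of (\<ge>) A)"
      by (rule partial_order_on_relation_ofI) auto
    fix C assume C: "C \<in> Chains (relation_of (\<ge>) A)"
    show "\<exists>u\<in>A. \<forall>a\<in>C. a \<ge> u"
    proof (cases "C = {}")
      case True
      then show ?thesis using p by (auto simp: A_def)
    next
      case False
      have CA: "C \<subseteq> A" using Chains_relation_of[OF C] .
      have total: "q \<le> r \<or> r \<le> q" if "q \<in> C" "r \<in> C" for q r
        using C that by (auto simp: Chains_def relation_of_def)
      define u where "u x = Inf ((\<lambda>q. q x) ` C)" for x
      have bdd: "bdd_below ((\<lambda>q. q x) ` C)" for x
      proof (rule bdd_belowI)
        fix y assume "y \<in> (\<lambda>q. q x) ` C"
        then obtain q where q: "q \<in> A" "y = q x" using CA by auto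
        then have "- p (- x) \<le> - q (- x)" by (simp add: A_def le_fun_def)
        also have "\<dots> \<le> y" using q sublinear_ge_minus[of q x] by (simp add: A_def)
        finally show "- p (- x) \<le> y" .
      qed
      have u_le: "u x \<le> q x" if "q \<in> C" for q x
        unfolding u_def using that by (intro cInf_lower[OF _ bdd]) auto
      have u_ge: "b \<le> u x" if "\<And>q. q \<in> C \<Longrightarrow> b \<le> q x" for b x
        unfolding u_def using False that by (intro cInf_greatest) auto
      have "u (x + y) \<le> u x + u y" for x y
      proof -
        have "u (x + y) \<le> q x + r y" if qr: "q \<in> C" "r \<in> C" for q r
        proof -
          obtain s where s: "s \<in> C" "s \<le> q" "s \<le> r" using total[OF qr] qr by auto
          have "u (x + y) \<le> s (x + y)" using u_le s by blast
          also have "\<dots> \<le> s x + s y" using s CA by (auto simp: A_def intro: sublinear_add)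
          also have "\<dots> \<le> q x + r y" using s by (auto simp: le_fun_def intro: add_mono)
          finally show ?thesis .
        qed
        then have "u (x + y) - r y \<le> u x" if "r \<in> C" for r
          using that by (intro u_ge) (auto simp: algebra_simps)
        then have "u (x + y) - u x \<le> u y"
          by (intro u_ge) (auto simp: algebra_simps)
        then show ?thesis by simp
      qed
      moreover have "u (t *\<^sub>R x) \<le> t * u x" if "0 \<le> t" for t x
      proof (cases "t = 0")
        case True
        obtain q where q: "q \<in> C" using False by blast
        then have "q 0 = 0" using CA by (auto simp: A_def sublinear_0)
        then show ?thesis using u_le[OF q, of 0] True by simp
      next
        case t: False
        have "u (t *\<^sub>R x) / t \<le> u x"
        proof (rule u_ge)
          fix q assume q: "q \<in> C"
          have "u (t *\<^sub>R x) \<le> t * q x"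
            using u_le[OF q, of "t *\<^sub>R x"] q CA sublinear_scale_le[of q t x] that
            by (auto simp: A_def)
          then show "u (t *\<^sub>R x) / t \<le> q x" using t that by (simp add: field_simps)
        qed
        then show ?thesis using t that by (simp add: field_simps)
      qed
      ultimately have "sublinear u" by (simp add: sublinear_def)
      moreover have "u \<le> p"
      proof -
        obtain q where q: "q \<in> C" using False by blast
        then have "u \<le> q" using u_le by (simp add: le_fun_def)
        then show ?thesis using q CA by (auto simp: A_def)
      qed
      ultimately have "u \<in> A" by (simp add: A_def)
      then show ?thesis using u_le by (auto simp: le_fun_def)
    qed
  qed
  then obtain m where m: "sublinear m" "m \<le> p"
    and min: "\<And>q. sublinear q \<Longrightarrow> q \<le> m \<Longrightarrow> q = m"
    unfolding A_def by (metis (mono_tags, lifting) mem_Collect_eq order_trans)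
  have odd: "m (- x) = - m x" for x
  proof -
    obtain q where q: "sublinear q" "\<And>y. q y \<le> m y" "\<And>c. c \<in> {x} \<Longrightarrow> q (- c) \<le> - m x"
      using sublinear_lowered_on_convex[OF m(1), of "{x}" "m x"] by auto
    have "q = m" using min[OF q(1)] q(2) by (simp add: le_fun_def)
    then have "m (- x) \<le> - m x" using q(3)[of x] by simp
    then show ?thesis using sublinear_ge_minus[OF m(1), of x] by simp
  qed
  have "m (x + y) = m x + m y" for x y
    using sublinear_add[OF m(1), of x y] sublinear_add[OF m(1), of "- x" "- y"]
      odd[of "x + y"] odd[of x] odd[of y] by simp
  moreover have "m (t *\<^sub>R x) = t * m x" for t x
  proof (cases "0 \<le> t")
    case True
    then show ?thesis by (rule sublinear_scale[OF m(1)])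
  next
    case False
    then have "m ((- t) *\<^sub>R x) = (- t) * m x" by (intro sublinear_scale[OF m(1)]) simp
    then show ?thesis using odd[of "t *\<^sub>R x"] by simp
  qed
  ultimately have "linear m" by (intro linearI) auto
  then show ?thesis using m(2) that by (auto simp: le_fun_def)
qed

text \<open>With \<open>d\<close> a lower bound for the distance from \<open>x\<close> to \<open>C\<close>, the norm is at least \<open>d\<close> on \<open>C - x\<close>.  A
  linear functional below the norm lowered on \<open>C - x\<close> is bounded and at least \<open>d\<close> on \<open>C - x\<close>.\<close>
lemma separation_from_closed_convex:
  fixes C :: "'a::real_normed_vector set"
  assumes C: "closed C" "convex C" and x: "x \<notin> C"
  shows "\<exists>(f :: 'a \<Rightarrow>\<^sub>L real) d. d > 0 \<and> (\<forall>c\<in>C. blinfun_apply f x + d \<le> blinfun_apply f c)"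
proof (cases "C = {}")
  case True
  then show ?thesis by (auto intro: exI[of _ 1])
next
  case False
  obtain d where d: "d > 0" "ball x d \<subseteq> - C"
    using C(1) x open_contains_ball[of "- C"] by (auto simp: open_Compl)
  have "convex ((\<lambda>c. c - x) ` C)" "(\<lambda>c. c - x) ` C \<noteq> {}"
    using C(2) False by (auto simp: convex_translation_subtract)
  moreover have "d \<le> norm c" if "c \<in> (\<lambda>c. c - x) ` C" for c
    using d that by (force simp: dist_norm norm_minus_commute)
  moreover have "sublinear (norm :: 'a \<Rightarrow> real)"
    by (auto simp: sublinear_def norm_triangle_ineq)
  ultimately obtain q where q: "sublinear q" "\<And>y. q y \<le> norm y"
      "\<And>c. c \<in> (\<lambda>c. c - x) ` C \<Longrightarrow> q (- c) \<le> - d"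
    using sublinear_lowered_on_convex[of norm "(\<lambda>c. c - x) ` C" d] by metis
  obtain f where f: "linear f" "\<And>y. f y \<le> q y"
    using sublinear_dominates_linear[OF q(1)] by blast
  have "\<bar>f y\<bar> \<le> norm y" for y
    using f(2)[of y] q(2)[of y] f(2)[of "- y"] q(2)[of "- y"] linear_neg[OF f(1), of y] by simp
  then have bl: "bounded_linear f"
    using f(1) by (auto simp: bounded_linear_def bounded_linear_axioms_def intro: exI[of _ 1])
  show ?thesis
  proof (intro exI[of _ "Blinfun f"] exI[of _ d] conjI ballI)
    fix c assume "c \<in> C"
    then have "f (x - c) \<le> - d" using q(3)[of "c - x"] f(2)[of "x - c"] by simp
    then show "blinfun_apply (Blinfun f) x + d \<le> blinfun_apply (Blinfun f) c"
      using linear_diff[OF f(1), of x c] by (simp add: bounded_linear_Blinfun_apply[OF bl])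
  qed (rule d(1))
qed

section \<open>Nested convex sets in reflexive spaces\<close>

text \<open>One half of Smulian's characterization of reflexivity.  Let \<open>s n f\<close> be the
  supremum of \<open>f\<close> over \<open>C n\<close>.  On the dual space, \<open>p = inf\<^sub>n s n\<close> is sublinear because the sets decrease.  A linear functional
  below \<open>p\<close> is an element of the bidual, hence evaluation at a point \<open>x\<close>.  So \<open>f x \<le> s n f\<close>
  for all \<open>f\<close> and \<open>n\<close>, and by separation \<open>x\<close> lies in every \<open>C n\<close>.\<close>
theorem reflexive_nested_convex_Inter:
  fixes C :: "nat \<Rightarrow> 'a::real_normed_vector set"
  assumes refl: "reflexive_space TYPE('a)"
    and C: "\<And>n. closed (C n)" "\<And>n. convex (C n)" "\<And>n. C n \<noteq> {}" "bounded (C 0)"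
    and nested: "\<And>m n. m \<le> n \<Longrightarrow> C n \<subseteq> C m"
  obtains x where "\<And>n. x \<in> C n"
proof -
  obtain R where R: "\<And>x. x \<in> C 0 \<Longrightarrow> norm x \<le> R"
    using C(4) by (auto simp: bounded_iff)
  define s where "s n f = (SUP x\<in>C n. blinfun_apply f x)" for n and f :: "'a \<Rightarrow>\<^sub>L real"
  define p where "p f = (INF n. s n f)" for f
  have val: "\<bar>blinfun_apply f x\<bar> \<le> R * norm f" if "x \<in> C n" for f :: "'a \<Rightarrow>\<^sub>L real" and x n
  proof -
    have "\<bar>blinfun_apply f x\<bar> \<le> norm f * norm x" using norm_blinfun[of f x] by simp
    also have "\<dots> \<le> norm f * R" using R nested[of 0 n] that by (intro mult_left_mono) auto
    finally show ?thesis by (simp add: mult.commute)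
  qed
  have bdd: "bdd_above (blinfun_apply f ` C n)" for f :: "'a \<Rightarrow>\<^sub>L real" and n
    using val[of _ n f] by (intro bdd_aboveI2[of _ _ "R * norm f"]) (auto simp: abs_le_iff)
  have s_upper: "blinfun_apply f x \<le> s n f" if "x \<in> C n" for f x n
    unfolding s_def using that by (intro cSUP_upper bdd)
  have s_least: "s n f \<le> b" if "\<And>x. x \<in> C n \<Longrightarrow> blinfun_apply f x \<le> b" for n f b
    unfolding s_def using that C(3) by (intro cSUP_least) auto
  have s_mono: "s n f \<le> s m f" if "m \<le> n" for m n f
    using nested[OF that] by (intro s_least s_upper) auto
  have s_abs: "\<bar>s n f\<bar> \<le> R * norm f" for n f
  proof -
    obtain x where x: "x \<in> C n" using C(3) by blast
    have "s n f \<le> R * norm f" using val by (intro s_least) (auto simp: abs_le_iff)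
    moreover have "- (R * norm f) \<le> s n f"
      using s_upper[OF x, of f] val[OF x, of f] by simp
    ultimately show ?thesis by simp
  qed
  have p_le: "p f \<le> s n f" for n f
    unfolding p_def using s_abs
    by (intro cINF_lower bdd_belowI2[of _ "- (R * norm f)"]) (auto simp: abs_le_iff minus_le_iff)
  have p_ge: "b \<le> p f" if "\<And>n. b \<le> s n f" for b f
    unfolding p_def using that by (intro cINF_greatest) auto
  have "p (f + g) \<le> p f + p g" for f g
  proof -
    have "p (f + g) \<le> s m f + s n g" for m n
    proof -
      have "p (f + g) \<le> s (max m n) (f + g)" by (rule p_le)
      also have "\<dots> \<le> s (max m n) f + s (max m n) g"
        by (intro s_least) (auto simp: blinfun.add_left intro!: add_mono s_upper)
      also have "\<dots> \<le> s m f + s n g" by (intro add_mono s_mono) auto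
      finally show ?thesis .
    qed
    then have "p (f + g) - s n g \<le> p f" for n
      by (intro p_ge) (simp add: algebra_simps)
    then have "p (f + g) - p f \<le> p g"
      by (intro p_ge) (simp add: algebra_simps)
    then show ?thesis by simp
  qed
  moreover have "p (t *\<^sub>R f) \<le> t * p f" if t: "0 \<le> t" for t f
  proof (cases "t = 0")
    case True
    then show ?thesis using p_le[of 0 0] s_abs[of 0 0] by simp
  next
    case False
    have "p (t *\<^sub>R f) / t \<le> p f"
    proof (rule p_ge)
      fix n
      have "p (t *\<^sub>R f) \<le> s n (t *\<^sub>R f)" by (rule p_le)
      also have "\<dots> \<le> t * s n f"
        using t by (intro s_least) (auto simp: blinfun.scaleR_left intro!: mult_left_mono s_upper)
      finally show "p (t *\<^sub>R f) / t \<le> s n f" using t False by (simp add: field_simps)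
    qed
    then show ?thesis using t False by (simp add: field_simps)
  qed
  ultimately have "sublinear p" by (simp add: sublinear_def)
  then obtain F where F: "linear F" "\<And>f. F f \<le> p f"
    using sublinear_dominates_linear by blast
  have F_le: "F f \<le> R * norm f" for f
    using F(2)[of f] p_le[of f 0] s_abs[of 0 f] by simp
  have "\<bar>F f\<bar> \<le> R * norm f" for f
    using F_le[of f] F_le[of "- f"] linear_neg[OF F(1), of f] by (simp add: abs_le_iff)
  then have "bounded_linear F"
    using F(1) by (auto simp: bounded_linear_def bounded_linear_axioms_def mult.commute intro!: exI[of _ R])
  then have "\<exists>x. \<forall>f. F f = blinfun_apply f x"
    using refl by (metis reflexive_space_def bounded_linear_Blinfun_apply)
  then obtain x where x: "\<And>f. F f = blinfun_apply f x" by blast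
  have "x \<in> C n" for n
  proof (rule ccontr)
    assume "x \<notin> C n"
    then obtain f :: "'a \<Rightarrow>\<^sub>L real" and d where fd: "d > 0" "\<forall>c\<in>C n. blinfun_apply f x + d \<le> blinfun_apply f c"
      using separation_from_closed_convex[OF C(1)[of n] C(2)[of n]] by blast
    have "s n (- f) \<le> - blinfun_apply f x - d"
      using fd(2) by (intro s_least) (fastforce simp: blinfun.minus_left)
    moreover have "- blinfun_apply f x \<le> s n (- f)"
      using F(2)[of "- f"] p_le[of "- f" n] x[of "- f"] by (simp add: blinfun.minus_left)
    ultimately show False using fd(1) by simp
  qed
  then show ?thesis by (rule that)
qed

text \<open>Passing to the limit in \<open>G (i x)\<close> needs only that the images of a minimizing sequence converge in
  \<open>Z\<close>.  Lower semicontinuity of \<open>\<Phi>\<close> is replaced by intersecting the convex sets \<open>C k\<close> below, on which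
  \<open>\<Phi>\<close> is at most \<open>m - G y + 1/(k+1)\<close> and \<open>i\<close> is within \<open>1/(k+1)\<close> of the limit \<open>y\<close>.\<close>
theorem convex_plus_compact_attains_min:
  fixes \<Phi> :: "'e::real_normed_vector \<Rightarrow> real" and G :: "'z::real_normed_vector \<Rightarrow> real"
  assumes refl: "reflexive_space TYPE('e)" and i: "compact_embedding i"
    and \<Phi>: "convex_on UNIV \<Phi>" "continuous_on UNIV \<Phi>" and G: "continuous_on UNIV G"
    and B: "closed B" "convex B" "bounded B" "B \<noteq> {}"
    and bdd: "bdd_below ((\<lambda>x. \<Phi> x + G (i x)) ` B)"
  obtains u where "u \<in> B" "\<And>x. x \<in> B \<Longrightarrow> \<Phi> u + G (i u) \<le> \<Phi> x + G (i x)"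
proof -
  have bl: "bounded_linear i" and cpt: "compact (closure (i ` B))"
    using i B(3) by (auto simp: compact_embedding_def)
  define J where "J x = \<Phi> x + G (i x)" for x
  define m where "m = (INF x\<in>B. J x)"
  have m_le: "m \<le> J x" if "x \<in> B" for x
    unfolding m_def using that bdd by (intro cINF_lower) (auto simp: J_def)
  have "\<exists>x\<in>B. J x < m + inverse (real (Suc n))" for n
    using cINF_less_iff[of B J "m + inverse (real (Suc n))"] B(4) bdd
    by (auto simp: m_def J_def)
  then have "\<forall>n. \<exists>v. v \<in> B \<and> J v < m + inverse (real (Suc n))" by blast
  from choice[OF this] obtain x where x: "\<And>n. x n \<in> B" "\<And>n. J (x n) < m + inverse (real (Suc n))"
    by blast
  obtain y r where r: "strict_mono r" "(\<lambda>n. i (x (r n))) \<longlonglongrightarrow> y"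
  proof -
    have "\<forall>n. i (x n) \<in> closure (i ` B)" using x(1) closure_subset[of "i ` B"] by auto
    then show ?thesis
      using cpt[unfolded compact_def, THEN spec[of _ "\<lambda>n. i (x n)"]] that
      by (auto simp: o_def)
  qed
  have Glim: "(\<lambda>n. G (i (x (r n)))) \<longlonglongrightarrow> G y"
    using G r(2) by (auto simp: continuous_on_def intro: tendsto_compose)
  define \<epsilon> where "\<epsilon> k = inverse (real (Suc k))" for k
  have \<epsilon>: "\<epsilon> k > 0" "\<epsilon> \<longlonglongrightarrow> 0" "n \<ge> k \<Longrightarrow> \<epsilon> n \<le> \<epsilon> k" for k n
    using LIMSEQ_inverse_real_of_nat by (auto simp: \<epsilon>_def[abs_def] intro!: le_imp_inverse_le)
  define C where "C k = B \<inter> {v. \<Phi> v \<le> m - G y + \<epsilon> k} \<inter> i -` cball y (\<epsilon> k)" for k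
  have "\<exists>v. \<forall>k. v \<in> C k"
  proof (rule reflexive_nested_convex_Inter[OF refl])
    fix k
    show "closed (C k)"
      unfolding C_def
      by (intro closed_Int B(1) closed_Collect_le \<Phi>(2) closed_vimage continuous_intros
          linear_continuous_on bl) auto
    have "convex {v. \<Phi> v \<le> m - G y + \<epsilon> k}"
      unfolding convex_def
    proof (intro allI impI ballI)
      fix a b and s t :: real
      assume a: "a \<in> {v. \<Phi> v \<le> m - G y + \<epsilon> k}" "b \<in> {v. \<Phi> v \<le> m - G y + \<epsilon> k}"
        and st: "0 \<le> s" "0 \<le> t" "s + t = 1"
      have "\<Phi> (s *\<^sub>R a + t *\<^sub>R b) \<le> s * \<Phi> a + t * \<Phi> b"
        using \<Phi>(1) st by (auto simp: convex_on_def)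
      also have "\<dots> \<le> m - G y + \<epsilon> k"
        using a st by (intro convex_bound_le) auto
      finally show "s *\<^sub>R a + t *\<^sub>R b \<in> {v. \<Phi> v \<le> m - G y + \<epsilon> k}" by simp
    qed
    then show "convex (C k)"
      unfolding C_def using bl
      by (intro convex_Int B(2) convex_linear_vimage bounded_linear.linear) auto
    have "(\<lambda>n. \<Phi> (x (r n))) \<longlonglongrightarrow> m - G y"
    proof -
      have "(\<lambda>n. J (x (r n))) \<longlonglongrightarrow> m"
      proof (rule tendsto_sandwich[of "\<lambda>_. m" _ _ "\<lambda>n. m + \<epsilon> (r n)"])
        show "(\<lambda>n. m + \<epsilon> (r n)) \<longlonglongrightarrow> m"
          using tendsto_add[OF tendsto_const, OF LIMSEQ_subseq_LIMSEQ[OF \<epsilon>(2) r(1)], of m]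
          by (simp add: o_def)
      qed (use m_le x in \<open>auto simp: \<epsilon>_def less_imp_le\<close>)
      from tendsto_diff[OF this Glim] show ?thesis by (simp add: J_def)
    qed
    then have "\<forall>\<^sub>F n in sequentially. \<Phi> (x (r n)) < m - G y + \<epsilon> k"
      using \<epsilon>(1) by (intro order_tendstoD) auto
    moreover have "\<forall>\<^sub>F n in sequentially. dist (i (x (r n))) y < \<epsilon> k"
      using r(2) \<epsilon>(1) by (auto simp: tendsto_iff)
    ultimately have "\<forall>\<^sub>F n in sequentially. x (r n) \<in> C k"
      by eventually_elim (use x(1) in \<open>auto simp: C_def dist_commute less_imp_le\<close>)
    then show "C k \<noteq> {}"
      by (auto dest: eventually_happens)
  next
    show "bounded (C 0)" using B(3) by (auto simp: C_def intro: bounded_subset)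
    show "C n \<subseteq> C k" if "k \<le> n" for k n
      using \<epsilon>(3)[OF that] by (auto simp: C_def)
  qed blast
  then obtain v where v: "\<And>k. v \<in> C k" by blast
  have "dist y (i v) \<le> 0"
    using v by (intro tendsto_lowerbound[OF \<epsilon>(2)]) (auto simp: C_def)
  then have iv: "i v = y" by simp
  have "\<Phi> v \<le> m - G y + 0"
    using v by (intro tendsto_lowerbound[OF tendsto_add[OF tendsto_const \<epsilon>(2)]]) (auto simp: C_def)
  then have "J v \<le> m" by (simp add: J_def iv)
  then show ?thesis
    using v[of 0] m_le that[of v] by (fastforce simp: C_def J_def)
qed

section \<open>Differentiable convex functions\<close>

lemma convex_above_tangent:
  fixes f :: "'a::real_normed_vector \<Rightarrow> real"
  assumes f: "convex_on UNIV f" and D: "(f has_derivative D) (at x)"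
  shows "f x + D (y - x) \<le> f y"
proof -
  define g where "g t = f (x + t *\<^sub>R (y - x))" for t
  interpret D: bounded_linear D using D by (rule has_derivative_bounded_linear)
  have "(g has_derivative (\<lambda>t. D (t *\<^sub>R (y - x)))) (at 0)"
    unfolding g_def
    by (rule has_derivative_compose[where f = "\<lambda>t. x + t *\<^sub>R (y - x)" and g = f, simplified])
      (auto intro!: derivative_eq_intros D)
  moreover have "(\<lambda>t. D (t *\<^sub>R (y - x))) = (*) (D (y - x))"
    by (simp add: fun_eq_iff D.scaleR)
  ultimately have "(g has_real_derivative D (y - x)) (at 0)"
    by (simp add: has_field_derivative_def)
  then have "((\<lambda>t. (g t - g 0) / t) \<longlongrightarrow> D (y - x)) (at 0)"
    by (simp add: has_field_derivative_iff)
  then have "((\<lambda>t. (g t - g 0) / t) \<longlongrightarrow> D (y - x)) (at_right 0)"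
    by (rule tendsto_within_subset) auto
  moreover have "\<forall>\<^sub>F t in at_right 0. (g t - g 0) / t \<le> f y - f x"
    unfolding eventually_at_right[OF zero_less_one]
  proof (intro exI[of _ 1] conjI allI impI)
    fix t :: real assume t: "0 < t" "t < 1"
    have "g t \<le> (1 - t) * f x + t * f y"
      using convex_onD[OF f, of t x y] t by (simp add: g_def algebra_simps)
    then show "(g t - g 0) / t \<le> f y - f x"
      using t by (simp add: g_def field_simps)
  qed simp
  ultimately have "D (y - x) \<le> f y - f x"
    by (intro tendsto_upperbound) auto
  then show ?thesis by simp
qed

text \<open>Let the tangent at \<open>x\<close> approximate \<open>f\<close> with relative error \<open>e/4\<close> on a ball of radius \<open>d\<close>.  For \<open>y\<close> near \<open>x\<close> and \<open>w\<close> of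
  length \<open>d/4\<close>, convexity bounds \<open>D y w\<close> by \<open>f (y + w) - f y\<close> and \<open>f y\<close> from below by the tangent
  at \<open>x\<close>, so only the error at \<open>y + w\<close> enters and \<open>(D y - D x) w\<close> is at most \<open>e/2\<close> times the
  length of \<open>w\<close>.\<close>
theorem convex_has_derivative_continuous:
  fixes f :: "'a::real_normed_vector \<Rightarrow> real" and D :: "'a \<Rightarrow> 'a \<Rightarrow>\<^sub>L real"
  assumes f: "convex_on UNIV f" and D: "\<And>x. (f has_derivative blinfun_apply (D x)) (at x)"
  shows "continuous_on UNIV D"
  unfolding continuous_on_iff
proof (intro ballI allI impI)
  fix x and e :: real assume e: "e > 0"
  have "e / 4 > 0" using e by simp
  then obtain d where d: "d > 0"
    "\<And>y. norm (y - x) < d \<Longrightarrow> norm (f y - f x - blinfun_apply (D x) (y - x)) \<le> e / 4 * norm (y - x)"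
    using D[of x] unfolding has_derivative_at_alt by blast
  have "dist (D y) (D x) < e" if y: "dist y x < d / 4" for y
  proof -
    have le: "blinfun_apply (D y - D x) v \<le> e / 2 * norm v" for v
    proof (cases "v = 0")
      case False
      define w where "w = (d / 4 / norm v) *\<^sub>R v"
      have nw: "norm w = d / 4" using False d(1) by (simp add: w_def)
      have n: "norm (y + w - x) \<le> d / 2"
        using norm_triangle_ineq[of "y - x" w] y nw by (simp add: dist_norm algebra_simps)
      have "f y + blinfun_apply (D y) w \<le> f (y + w)"
        using convex_above_tangent[OF f D, of y "y + w"] by simp
      moreover have "f x + blinfun_apply (D x) (y - x) \<le> f y"
        by (rule convex_above_tangent[OF f D])
      moreover have "f (y + w) \<le> f x + blinfun_apply (D x) (y + w - x) + e / 4 * norm (y + w - x)"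
        using d(2)[of "y + w"] n d(1) unfolding real_norm_def by linarith
      moreover have "e / 4 * norm (y + w - x) \<le> e / 4 * (d / 2)"
        using n e by (intro mult_left_mono) auto
      moreover have "blinfun_apply (D x) (y + w - x) = blinfun_apply (D x) (y - x) + blinfun_apply (D x) w"
        by (simp add: blinfun.bilinear_simps)
      ultimately have "blinfun_apply (D y - D x) w \<le> e / 2 * norm w"
        by (simp add: blinfun.diff_left nw)
      then have "(d / 4 / norm v) * blinfun_apply (D y - D x) v \<le> (d / 4 / norm v) * (e / 2 * norm v)"
        using False d(1) by (simp add: w_def blinfun.scaleR_right mult.commute)
      then show ?thesis by (rule mult_left_le_imp_le) (use False d(1) in simp)
    qed simp
    have "norm (blinfun_apply (D y - D x) v) \<le> e / 2 * norm v" for v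
      using le[of v] le[of "- v"] by (simp add: abs_le_iff blinfun.minus_right)
    then have "norm (D y - D x) \<le> e / 2"
      using e by (intro norm_blinfun_bound) auto
    then show ?thesis using e by (simp add: dist_norm)
  qed
  then show "\<exists>d>0. \<forall>y\<in>UNIV. dist y x < d \<longrightarrow> dist (D y) (D x) < e"
    using d(1) by (intro exI[of _ "d / 4"]) auto
qed

text \<open>The derivative at \<open>t y\<close> is nonnegative in direction \<open>y\<close>, so the tangents at points \<open>t y\<close> with
  \<open>t\<close> tending to \<open>0\<close> show that \<open>0\<close> minimizes \<open>\<Phi>\<close>.  The tangent at \<open>x / 2\<close> then gives a definite
  growth on the second half of the segment from \<open>0\<close> to \<open>x\<close>.\<close>
lemma convex_coercive_growth:
  fixes \<Phi> :: "'a::real_normed_vector \<Rightarrow> real" and \<phi> :: "'a \<Rightarrow> 'a \<Rightarrow>\<^sub>L real"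
  assumes \<Phi>: "convex_on UNIV \<Phi>" "\<And>v. (\<Phi> has_derivative blinfun_apply (\<phi> v)) (at v)"
    and \<gamma>: "0 \<le> \<gamma>" "\<And>v. \<gamma> * norm v powr \<alpha> \<le> blinfun_apply (\<phi> v) v"
  shows "\<Phi> 0 + \<gamma> * (norm x / 2) powr \<alpha> \<le> \<Phi> x"
proof -
  have min0: "\<Phi> 0 \<le> \<Phi> y" for y
  proof -
    define t where "t n = inverse (real (Suc n))" for n
    have t: "t n > 0" "t n \<le> 1" "t \<longlonglongrightarrow> 0" for n
      using LIMSEQ_inverse_real_of_nat by (auto simp: t_def[abs_def] field_simps)
    have "\<Phi> (t n *\<^sub>R y) \<le> \<Phi> y" for n
    proof -
      have "0 \<le> blinfun_apply (\<phi> (t n *\<^sub>R y)) (t n *\<^sub>R y)"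
        using \<gamma>(1) by (intro order_trans[OF _ \<gamma>(2)]) simp
      then have "0 \<le> blinfun_apply (\<phi> (t n *\<^sub>R y)) y"
        using t(1)[of n] by (simp add: blinfun.scaleR_right zero_le_mult_iff)
      then have "0 \<le> blinfun_apply (\<phi> (t n *\<^sub>R y)) ((1 - t n) *\<^sub>R y)"
        using t(2)[of n] by (simp add: blinfun.scaleR_right)
      then show ?thesis
        using convex_above_tangent[OF \<Phi>(1,2), of "t n *\<^sub>R y" y] by (simp add: scaleR_diff_left)
    qed
    moreover have "(\<lambda>n. \<Phi> (t n *\<^sub>R y)) \<longlonglongrightarrow> \<Phi> (0 *\<^sub>R y)"
      by (intro isCont_tendsto_compose[OF has_derivative_continuous[OF \<Phi>(2)]] tendsto_intros t)
    ultimately show ?thesis by (auto intro: tendsto_upperbound)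
  qed
  have half: "x - x /\<^sub>R 2 = x /\<^sub>R 2"
    using scaleR_half_double[of x] by (simp add: diff_eq_eq flip: scaleR_add_left)
  have "\<gamma> * norm (x /\<^sub>R 2) powr \<alpha> \<le> blinfun_apply (\<phi> (x /\<^sub>R 2)) (x - x /\<^sub>R 2)"
    using \<gamma>(2)[of "x /\<^sub>R 2"] half by simp
  then show ?thesis
    using convex_above_tangent[OF \<Phi>(1,2), of "x /\<^sub>R 2" x] min0[of "x /\<^sub>R 2"] by simp
qed

section \<open>Ekeland's variational principle\<close>

text \<open>Write \<open>T x\<close> for the points that are lower than \<open>x\<close> by at least \<open>\<epsilon>\<close> times their distance to \<open>x\<close>; this
  is a transitive relation.  Iterating, each step picks a point of \<open>T x\<close> whose value is at or
  below the midpoint between \<open>f x\<close> and the infimum over \<open>T x\<close>.  The values decrease to some \<open>L\<close>, which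
  makes the sequence Cauchy, and its limit \<open>y\<close> lies in every \<open>T (x n)\<close>.  A point of \<open>T y\<close> has
  value at least \<open>L\<close> by the choice of the steps, so it cannot be strictly below \<open>y\<close>.\<close>
theorem ekeland_variational_principle:
  fixes f :: "'a::complete_space \<Rightarrow> real"
  assumes S: "closed S" "x0 \<in> S" and bdd: "bdd_below (f ` S)"
    and lsc: "\<And>a. closed {x \<in> S. f x \<le> a}" and \<epsilon>: "\<epsilon> > 0"
  obtains y where "y \<in> S" "f y \<le> f x0" "\<And>x. x \<in> S \<Longrightarrow> f y \<le> f x + \<epsilon> * dist x y"
proof -
  define T where "T x = {y \<in> S. f y + \<epsilon> * dist x y \<le> f x}" for x
  \<comment> \<open>The midpoint condition \<open>f y \<le> (f x + inf f (T x)) / 2\<close>, multiplied out and without the infimum.\<close>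
  have "\<exists>y\<in>T x. \<forall>z\<in>T x. 2 * f y - f x \<le> f z" if x: "x \<in> S" for x
  proof (cases "\<forall>z\<in>T x. f x \<le> f z")
    case True
    then show ?thesis using x by (intro bexI[of _ x]) (auto simp: T_def)
  next
    case False
    then obtain z where z: "z \<in> T x" "f z < f x" by force
    define m where "m = Inf (f ` T x)"
    have bT: "bdd_below (f ` T x)" using bdd by (rule bdd_below_mono) (auto simp: T_def)
    have "m \<le> f z" unfolding m_def using z by (intro cInf_lower bT) auto
    then have "m < (f x + m) / 2" using z by simp
    then obtain y where y: "y \<in> T x" "f y < (f x + m) / 2"
      using cInf_lessD[of "f ` T x" "(f x + m) / 2"] z by (auto simp: m_def)
    moreover have "m \<le> f w" if "w \<in> T x" for w
      unfolding m_def using that by (intro cInf_lower bT) auto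
    ultimately show ?thesis by (intro bexI[of _ y]) fastforce+
  qed
  then have "\<forall>x\<in>S. \<exists>y. y \<in> T x \<and> (\<forall>z\<in>T x. 2 * f y - f x \<le> f z)" by blast
  from bchoice[OF this] obtain g where
    g: "\<And>x. x \<in> S \<Longrightarrow> g x \<in> T x" "\<And>x z. x \<in> S \<Longrightarrow> z \<in> T x \<Longrightarrow> 2 * f (g x) - f x \<le> f z" by blast
  define x where "x n = (g ^^ n) x0" for n
  have x_Suc: "x (Suc n) = g (x n)" for n by (simp add: x_def)
  have xS: "x n \<in> S" for n
  proof (induction n)
    case (Suc n)
    then show ?case using g(1) by (auto simp: x_Suc T_def)
  qed (simp add: x_def S)
  have T_trans: "z \<in> T x" if "y \<in> T x" "z \<in> T y" for x y z
  proof -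
    have "\<epsilon> * dist x z \<le> \<epsilon> * dist x y + \<epsilon> * dist y z"
      using \<epsilon> dist_triangle[of x z y] by (simp add: distrib_left[symmetric])
    then show ?thesis using that by (auto simp: T_def)
  qed
  have xT: "x m \<in> T (x n)" if "n \<le> m" for m n
    using that
  proof (induction m rule: dec_induct)
    case base
    show ?case using xS by (simp add: T_def)
  next
    case (step m)
    then show ?case using T_trans g(1)[OF xS, of m] by (simp add: x_Suc)
  qed
  have x_dist: "\<epsilon> * dist (x n) (x m) \<le> f (x n) - f (x m)" if "n \<le> m" for m n
    using xT[OF that] by (simp add: T_def)
  have dec: "decseq (\<lambda>n. f (x n))"
  proof (rule decseq_SucI)
    fix n
    have "0 \<le> \<epsilon> * dist (x n) (x (Suc n))" using \<epsilon> by simp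
    then show "f (x (Suc n)) \<le> f (x n)" using x_dist[of n "Suc n"] by simp
  qed
  obtain B where B: "\<And>x. x \<in> S \<Longrightarrow> B \<le> f x" using bdd by (auto simp: bdd_below_def)
  obtain L where L: "(\<lambda>n. f (x n)) \<longlonglongrightarrow> L" "\<And>n. L \<le> f (x n)"
    using decseq_convergent[OF dec, of B] B xS by blast
  have "Cauchy x"
    unfolding Cauchy_altdef
  proof (intro allI impI)
    fix e :: real assume e: "e > 0"
    have "\<forall>\<^sub>F n in sequentially. f (x n) < L + \<epsilon> * e"
      using L(1) e \<epsilon> by (intro order_tendstoD) auto
    then obtain N where N: "\<And>n. n \<ge> N \<Longrightarrow> f (x n) < L + \<epsilon> * e"
      by (auto simp: eventually_sequentially)
    have "dist (x m) (x n) < e" if mn: "m \<ge> N" "n > m" for m n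
    proof -
      have "\<epsilon> * dist (x m) (x n) \<le> f (x m) - f (x n)" using mn by (intro x_dist) simp
      also have "\<dots> < \<epsilon> * e" using N[OF mn(1)] L(2)[of n] by simp
      finally show ?thesis using \<epsilon> by simp
    qed
    then show "\<exists>M. \<forall>m\<ge>M. \<forall>n>m. dist (x m) (x n) < e" by blast
  qed
  then obtain y where y: "x \<longlonglongrightarrow> y" by (auto simp: Cauchy_convergent_iff convergent_def)
  have yS: "y \<in> S" using closed_sequentially[OF S(1) _ y] xS by blast
  have "f y \<le> f (x n)" for n
  proof -
    have "y \<in> {z \<in> S. f z \<le> f (x n)}"
    proof (rule Lim_in_closed_set[OF lsc _ _ y])
      show "\<forall>\<^sub>F m in sequentially. x m \<in> {z \<in> S. f z \<le> f (x n)}"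
        using eventually_ge_at_top[of n]
        by eventually_elim (use xS dec in \<open>auto simp: decseq_def\<close>)
    qed simp
    then show ?thesis by simp
  qed
  then have fy: "f y \<le> f (x n)" "f y \<le> L" for n
    using tendsto_lowerbound[OF L(1), of "f y"] by auto
  have yT: "y \<in> T (x n)" for n
  proof -
    have "(\<lambda>m. \<epsilon> * dist (x n) (x m)) \<longlonglongrightarrow> \<epsilon> * dist (x n) y"
      by (intro tendsto_intros y)
    moreover have "\<forall>\<^sub>F m in sequentially. \<epsilon> * dist (x n) (x m) \<le> f (x n) - L"
      using eventually_ge_at_top[of n]
    proof eventually_elim
      case (elim m)
      then show ?case using x_dist[OF elim] L(2)[of m] by simp
    qed
    ultimately have "\<epsilon> * dist (x n) y \<le> f (x n) - L"
      by (intro tendsto_upperbound) auto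
    then show ?thesis using fy(2) yS by (simp add: T_def)
  qed
  have "f y \<le> f z + \<epsilon> * dist z y" if z: "z \<in> S" for z
  proof (rule ccontr)
    assume neg: "\<not> f y \<le> f z + \<epsilon> * dist z y"
    then have "z \<in> T y" using z by (simp add: T_def dist_commute)
    then have "2 * f (x (Suc n)) - f (x n) \<le> f z" for n
      using g(2)[OF xS T_trans[OF yT]] by (simp add: x_Suc)
    then have "2 * L - L \<le> f z"
      by (intro tendsto_upperbound[OF tendsto_diff[OF tendsto_mult[OF tendsto_const LIMSEQ_Suc[OF L(1)]] L(1)]]) auto
    moreover have "0 \<le> \<epsilon> * dist z y" using \<epsilon> by simp
    ultimately show False using neg fy(2) by simp
  qed
  moreover have "f y \<le> f x0" using fy(1)[of 0] by (simp add: x_def)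
  ultimately show ?thesis using that yS by blast
qed

section \<open>The mountain pass theorem\<close>

lemma norm_blinfun_less_witness:
  fixes f :: "'a::real_normed_vector \<Rightarrow>\<^sub>L real"
  assumes "0 \<le> c" "c < norm f"
  obtains x where "norm x \<le> 1" "c < blinfun_apply f x"
proof (rule ccontr)
  assume "\<not> thesis"
  with that have le: "blinfun_apply f x \<le> c" if "norm x \<le> 1" for x
    using \<open>norm x \<le> 1\<close> by force
  have "norm (blinfun_apply f x) \<le> c * norm x" for x
  proof (cases "x = 0")
    case False
    have "blinfun_apply f (x /\<^sub>R norm x) \<le> c" "blinfun_apply f (- (x /\<^sub>R norm x)) \<le> c"
      using False by (auto intro!: le)
    then show ?thesis
      using False by (simp add: blinfun.scaleR_right blinfun.minus_right abs_le_iff field_simps)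
  qed simp
  then have "norm f \<le> c" using assms(1) by (intro norm_blinfun_bound)
  then show False using assms(2) by simp
qed

text \<open>Glue the locally constant selections with a partition of unity; convexity keeps the weighted
  means inside \<open>P s\<close>.  In the mountain pass argument this produces a field of descent directions
  along a path, a weak form of a pseudo-gradient.\<close>
lemma continuous_selection_of_convex_sets:
  fixes P :: "'s::metric_space \<Rightarrow> 'a::real_normed_vector set"
  assumes K: "compact K" and cvx: "\<And>s. s \<in> K \<Longrightarrow> convex (P s)"
    and loc: "\<And>s. s \<in> K \<Longrightarrow> \<exists>x U. open U \<and> s \<in> U \<and> (\<forall>r\<in>U \<inter> K. x \<in> P r)"
  obtains v where "continuous_on K v" "\<And>s. s \<in> K \<Longrightarrow> v s \<in> P s"
proof -
  define \<U> where "\<U> = {U. open U \<and> (\<exists>x. \<forall>r\<in>U \<inter> K. x \<in> P r)}"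
  have "K \<subseteq> \<Union>\<U>" using loc unfolding \<U>_def by blast
  moreover have "\<forall>U\<in>\<U>. open U" by (simp add: \<U>_def)
  ultimately have "\<exists>\<C>\<subseteq>\<U>. finite \<C> \<and> K \<subseteq> \<Union>\<C>"
    using K[unfolded compact_eq_Heine_Borel, THEN spec[of _ \<U>]] by blast
  then obtain \<C> where C: "\<C> \<subseteq> \<U>" "finite \<C>" "K \<subseteq> \<Union>\<C>" by blast
  have "\<forall>U\<in>\<C>. \<exists>x. \<forall>r\<in>U \<inter> K. x \<in> P r" using C(1) by (auto simp: \<U>_def)
  from bchoice[OF this] obtain c where c: "\<And>U r. U \<in> \<C> \<Longrightarrow> r \<in> U \<Longrightarrow> r \<in> K \<Longrightarrow> c U \<in> P r"
    by blast
  have opC: "open U" if "U \<in> \<C>" for U using that C(1) by (auto simp: \<U>_def)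
  have locfin: "\<exists>V. open V \<and> s \<in> V \<and> finite {U \<in> \<C>. U \<inter> V \<noteq> {}}" for s
    using C(2) by (intro exI[of _ UNIV]) auto
  obtain F :: "'s set \<Rightarrow> 's \<Rightarrow> real" where
    F: "\<And>U. U \<in> \<C> \<Longrightarrow> continuous_on K (F U) \<and> (\<forall>s\<in>K. 0 \<le> F U s)"
      "\<And>s U. \<lbrakk>U \<in> \<C>; s \<in> K; s \<notin> U\<rbrakk> \<Longrightarrow> F U s = 0"
      "\<And>s. s \<in> K \<Longrightarrow> supp_sum (\<lambda>U. F U s) \<C> = 1"
  proof (rule subordinate_partition_of_unity[OF C(3)], goal_cases)
    case 1
    from 1(2) show ?case by (rule opC)
  next
    case 2
    show ?case by (rule locfin)
  next
    case (3 F)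
    from 3(2-4) show ?case by (rule 3(1))
  qed
  define v where "v s = (\<Sum>U\<in>\<C>. F U s *\<^sub>R c U)" for s
  have "continuous_on K v"
    unfolding v_def using F(1) by (intro continuous_intros) auto
  moreover have "v s \<in> P s" if s: "s \<in> K" for s
  proof -
    define \<C>' where "\<C>' = {U \<in> \<C>. F U s \<noteq> 0}"
    have "(\<Sum>U\<in>\<C>'. F U s *\<^sub>R c U) \<in> P s"
    proof (rule convex_sum)
      show "finite \<C>'" using C(2) by (simp add: \<C>'_def)
      show "(\<Sum>U\<in>\<C>'. F U s) = 1" using F(3)[OF s] by (simp add: \<C>'_def supp_sum_def support_on_def)
      show "c U \<in> P s" if U: "U \<in> \<C>'" for U
      proof -
        have "s \<in> U" using U F(2)[of U s] s by (auto simp: \<C>'_def)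
        then show ?thesis using U c s by (auto simp: \<C>'_def)
      qed
    qed (use F(1) s cvx in \<open>auto simp: \<C>'_def\<close>)
    also have "(\<Sum>U\<in>\<C>'. F U s *\<^sub>R c U) = v s"
      unfolding v_def \<C>'_def using C(2) by (intro sum.mono_neutral_left) auto
    finally show ?thesis .
  qed
  ultimately show ?thesis by (rule that)
qed

text \<open>A one-sided envelope estimate: if pushing a path in direction \<open>-v\<close> for a time \<open>s\<close> never lowers its
  maximum \<open>m\<close> by more than \<open>\<epsilon> s\<close>, then at some point where the maximum is attained the slope along
  \<open>v\<close> is at most \<open>\<epsilon>\<close>.  Such a point is a limit of near-maximum points of the pushed paths; the
  mean value theorem supplies the slope bound, which passes to the limit because \<open>D\<close> is
  continuous.\<close>
lemma peak_slope_le: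
  fixes J :: "'a::real_normed_vector \<Rightarrow> real" and D :: "'a \<Rightarrow> 'a \<Rightarrow>\<^sub>L real"
    and \<gamma> v :: "'s::metric_space \<Rightarrow> 'a"
  assumes deriv: "\<And>x. (J has_derivative blinfun_apply (D x)) (at x)"
    and D: "continuous_on UNIV D"
    and K: "compact K" and \<gamma>: "continuous_on K \<gamma>" and v: "continuous_on K v"
    and le: "\<And>t. t \<in> K \<Longrightarrow> J (\<gamma> t) \<le> m"
    and push: "\<And>s. 0 < s \<Longrightarrow> \<exists>t\<in>K. m \<le> J (\<gamma> t - s *\<^sub>R v t) + \<epsilon> * s"
  obtains t where "t \<in> K" "J (\<gamma> t) = m" "blinfun_apply (D (\<gamma> t)) (v t) \<le> \<epsilon>"
proof -
  define s where "s n = inverse (real (Suc n))" for n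
  have s: "s n > 0" "s \<longlonglongrightarrow> 0" for n
    using LIMSEQ_inverse_real_of_nat by (auto simp: s_def[abs_def])
  have "\<exists>t \<theta>. t \<in> K \<and> m \<le> J (\<gamma> t - s n *\<^sub>R v t) + \<epsilon> * s n \<and> \<theta> \<in> {0<..<s n} \<and>
          blinfun_apply (D (\<gamma> t - \<theta> *\<^sub>R v t)) (v t) \<le> \<epsilon>" for n
  proof -
    obtain t where t: "t \<in> K" "m \<le> J (\<gamma> t - s n *\<^sub>R v t) + \<epsilon> * s n"
      using push[OF s(1)[of n]] by blast
    have "((\<lambda>r. J (\<gamma> t - r *\<^sub>R v t)) has_derivative
        (\<lambda>h. blinfun_apply (D (\<gamma> t - r *\<^sub>R v t)) (- (h *\<^sub>R v t)))) (at r within {0..s n})" for r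
      by (rule has_derivative_compose[OF _ deriv]) (auto intro!: derivative_eq_intros)
    then obtain \<theta> where \<theta>: "\<theta> \<in> {0<..<s n}"
      "J (\<gamma> t - s n *\<^sub>R v t) - J (\<gamma> t - 0 *\<^sub>R v t) =
        blinfun_apply (D (\<gamma> t - \<theta> *\<^sub>R v t)) (- ((s n - 0) *\<^sub>R v t))"
      using mvt_simple[OF s(1)[of n], of "\<lambda>r. J (\<gamma> t - r *\<^sub>R v t)"
          "\<lambda>r h. blinfun_apply (D (\<gamma> t - r *\<^sub>R v t)) (- (h *\<^sub>R v t))"] by blast
    then have "J (\<gamma> t - s n *\<^sub>R v t) - J (\<gamma> t) = - (s n * blinfun_apply (D (\<gamma> t - \<theta> *\<^sub>R v t)) (v t))"
      by (simp add: blinfun.minus_right blinfun.scaleR_right)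
    then have "s n * blinfun_apply (D (\<gamma> t - \<theta> *\<^sub>R v t)) (v t) \<le> \<epsilon> * s n"
      using t(2) le[OF t(1)] by linarith
    then have "blinfun_apply (D (\<gamma> t - \<theta> *\<^sub>R v t)) (v t) \<le> \<epsilon>"
      using s(1)[of n] by (simp add: mult.commute[of \<epsilon>])
    then show ?thesis using t \<theta>(1) by blast
  qed
  then have "\<forall>n. \<exists>p. fst p \<in> K \<and> m \<le> J (\<gamma> (fst p) - s n *\<^sub>R v (fst p)) + \<epsilon> * s n \<and>
      snd p \<in> {0<..<s n} \<and>
      blinfun_apply (D (\<gamma> (fst p) - snd p *\<^sub>R v (fst p))) (v (fst p)) \<le> \<epsilon>"
    by simp
  from choice[OF this] obtain p where p: "\<And>n. fst (p n) \<in> K"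
    "\<And>n. m \<le> J (\<gamma> (fst (p n)) - s n *\<^sub>R v (fst (p n))) + \<epsilon> * s n"
    "\<And>n. snd (p n) \<in> {0<..<s n}"
    "\<And>n. blinfun_apply (D (\<gamma> (fst (p n)) - snd (p n) *\<^sub>R v (fst (p n)))) (v (fst (p n))) \<le> \<epsilon>"
    by blast
  have "\<exists>l\<in>K. \<exists>r. strict_mono r \<and> ((\<lambda>n. fst (p n)) \<circ> r) \<longlonglongrightarrow> l"
    using K[unfolded compact_def, THEN spec[of _ "\<lambda>n. fst (p n)"]] p(1) by blast
  then obtain t r where t: "t \<in> K" and r: "strict_mono r" "(\<lambda>n. fst (p (r n))) \<longlonglongrightarrow> t"
    by (auto simp: o_def)
  have s_r: "(\<lambda>n. s (r n)) \<longlonglongrightarrow> 0"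
    using LIMSEQ_subseq_LIMSEQ[OF s(2) r(1)] by (simp add: o_def)
  have \<theta>_r: "(\<lambda>n. snd (p (r n))) \<longlonglongrightarrow> 0"
    by (rule tendsto_sandwich[OF _ _ tendsto_const s_r]) (use p(3) in \<open>auto simp: less_imp_le\<close>)
  have \<gamma>_r: "(\<lambda>n. \<gamma> (fst (p (r n)))) \<longlonglongrightarrow> \<gamma> t"
    using continuous_on_tendsto_compose[OF \<gamma> r(2) t] p(1) by simp
  have v_r: "(\<lambda>n. v (fst (p (r n)))) \<longlonglongrightarrow> v t"
    using continuous_on_tendsto_compose[OF v r(2) t] p(1) by simp
  have "(\<lambda>n. \<gamma> (fst (p (r n))) - s (r n) *\<^sub>R v (fst (p (r n)))) \<longlonglongrightarrow> \<gamma> t - 0 *\<^sub>R v t"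
    by (intro tendsto_intros \<gamma>_r v_r s_r)
  moreover have "isCont J (\<gamma> t)" by (rule has_derivative_continuous[OF deriv])
  ultimately have "(\<lambda>n. J (\<gamma> (fst (p (r n))) - s (r n) *\<^sub>R v (fst (p (r n)))) + \<epsilon> * s (r n)) \<longlonglongrightarrow> J (\<gamma> t) + \<epsilon> * 0"
    by (intro tendsto_add tendsto_mult tendsto_const s_r) (auto intro: isCont_tendsto_compose)
  then have "m \<le> J (\<gamma> t) + \<epsilon> * 0"
    by (rule tendsto_lowerbound) (use p(2) in auto)
  then have "J (\<gamma> t) = m" using le[OF t] by simp
  moreover have "blinfun_apply (D (\<gamma> t)) (v t) \<le> \<epsilon>"
  proof -
    have "(\<lambda>n. \<gamma> (fst (p (r n))) - snd (p (r n)) *\<^sub>R v (fst (p (r n)))) \<longlonglongrightarrow> \<gamma> t - 0 *\<^sub>R v t"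
      by (intro tendsto_intros \<gamma>_r v_r \<theta>_r)
    then have "(\<lambda>n. D (\<gamma> (fst (p (r n))) - snd (p (r n)) *\<^sub>R v (fst (p (r n))))) \<longlonglongrightarrow> D (\<gamma> t)"
      using continuous_on_tendsto_compose[OF D] by fastforce
    then have "(\<lambda>n. blinfun_apply (D (\<gamma> (fst (p (r n))) - snd (p (r n)) *\<^sub>R v (fst (p (r n))))) (v (fst (p (r n)))))
        \<longlonglongrightarrow> blinfun_apply (D (\<gamma> t)) (v t)"
      by (intro tendsto_intros v_r)
    then show ?thesis by (rule tendsto_upperbound) (use p(4) in auto)
  qed
  ultimately show ?thesis using that t by blast
qed

text \<open>The peak height is lower semicontinuous on the complete space of paths and bounded below by \<open>\<kappa>\<close>, so
  Ekeland's principle gives a path whose peak cannot be lowered at a rate faster than \<open>\<epsilon>\<close>.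
  If \<open>D\<close> had norm above \<open>\<epsilon>\<close> at all its highest points, a continuous field of directions \<open>v\<close> with slope
  above \<open>\<epsilon>\<close> at those points, and zero at the endpoints so that the pushed paths are
  admissible, would contradict \<open>peak_slope_le\<close>.  The upper bound \<open>L\<close> is the peak of the
  initial path, so it is the same for every \<open>\<epsilon>\<close>.\<close>
lemma mountain_pass_almost_critical:
  fixes J :: "'a::banach \<Rightarrow> real" and D :: "'a \<Rightarrow> 'a \<Rightarrow>\<^sub>L real"
  assumes deriv: "\<And>x. (J has_derivative blinfun_apply (D x)) (at x)"
    and D: "continuous_on UNIV D"
    and ab: "J a < \<kappa>" "J b < \<kappa>"
    and cross: "\<And>g. continuous_on {0..1} g \<Longrightarrow> g 0 = a \<Longrightarrow> g 1 = b \<Longrightarrow> \<exists>t\<in>{0..1::real}. \<kappa> \<le> J (g t)"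
  obtains L where "\<And>\<epsilon>. \<epsilon> > 0 \<Longrightarrow> \<exists>x. \<kappa> \<le> J x \<and> J x \<le> L \<and> norm (D x) \<le> \<epsilon>"
proof -
  define P :: "(real \<Rightarrow>\<^sub>C 'a) set" where "P = {g. apply_bcontfun g 0 = a \<and> apply_bcontfun g 1 = b}"
  define peak where "peak g = (SUP t\<in>{0..1}. J (apply_bcontfun g t))" for g :: "real \<Rightarrow>\<^sub>C 'a"
  have J: "continuous_on UNIV J"
    using has_derivative_continuous[OF deriv] by (simp add: continuous_at_imp_continuous_on)
  have Jg: "continuous_on {0..1} (\<lambda>t. J (apply_bcontfun g t))" for g :: "real \<Rightarrow>\<^sub>C 'a"
    by (rule continuous_on_compose2[OF J]) auto
  have bdd: "bdd_above ((\<lambda>t. J (apply_bcontfun g t)) ` {0..1})" for g :: "real \<Rightarrow>\<^sub>C 'a"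
    by (intro bounded_imp_bdd_above compact_imp_bounded compact_continuous_image Jg compact_Icc)
  have le_peak: "J (apply_bcontfun g t) \<le> peak g" if "t \<in> {0..1}" for g t
    unfolding peak_def using that by (intro cSUP_upper bdd)
  have peak_le: "peak g \<le> c" if "\<And>t. t \<in> {0..1} \<Longrightarrow> J (apply_bcontfun g t) \<le> c" for g c
    unfolding peak_def using that by (intro cSUP_least) auto
  have attained: "\<exists>t\<in>{0..1}. J (apply_bcontfun g t) = peak g" for g
  proof -
    obtain t where t: "t \<in> {0..1}" "\<And>s. s \<in> {0..1} \<Longrightarrow> J (apply_bcontfun g s) \<le> J (apply_bcontfun g t)"
      using continuous_attains_sup[OF compact_Icc _ Jg[of g]] by auto
    then show ?thesis using le_peak[OF t(1)] peak_le[OF t(2)] by (intro bexI[of _ t]) (auto intro: antisym)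
  qed
  have eval: "continuous_on UNIV (\<lambda>g :: real \<Rightarrow>\<^sub>C 'a. apply_bcontfun g t)" for t
    unfolding continuous_on_iff by (meson dist_fun_lt_imp_dist_val_lt)
  have closed_P: "closed P"
  proof -
    have "P = {g. apply_bcontfun g 0 = a} \<inter> {g. apply_bcontfun g 1 = b}" by (auto simp: P_def)
    then show ?thesis by (simp add: closed_Int closed_Collect_eq eval)
  qed
  have lsc: "closed {g \<in> P. peak g \<le> c}" for c
  proof -
    have "{g \<in> P. peak g \<le> c} = P \<inter> (\<Inter>t\<in>{0..1}. {g. J (apply_bcontfun g t) \<le> c})"
    proof -
      have "peak g \<le> c \<longleftrightarrow> (\<forall>t\<in>{0..1}. J (apply_bcontfun g t) \<le> c)" for g
        using le_peak peak_le order_trans by blast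
      then show ?thesis by auto
    qed
    moreover have "closed {g :: real \<Rightarrow>\<^sub>C 'a. J (apply_bcontfun g t) \<le> c}" for t
      by (intro closed_Collect_le continuous_on_compose2[OF J eval] continuous_intros) auto
    ultimately show ?thesis using closed_P by (simp add: closed_Int closed_INT)
  qed
  have peak_ge: "\<kappa> \<le> peak g" if gP: "g \<in> P" for g
  proof -
    obtain t where t: "t \<in> {0..1}" "\<kappa> \<le> J (apply_bcontfun g t)"
      using cross[of "apply_bcontfun g"] gP by (auto simp: P_def)
    show ?thesis by (rule order_trans[OF t(2) le_peak[OF t(1)]])
  qed
  define clip :: "real \<Rightarrow> real" where "clip t = max 0 (min 1 t)" for t
  have clip: "continuous_on UNIV clip" "clip t \<in> {0..1}" "t \<in> {0..1} \<Longrightarrow> clip t = t" for t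
    by (auto simp: clip_def intro!: continuous_intros)
  \<comment> \<open>Paths are bounded continuous functions on the whole line; clipping the parameter extends a map on \<open>{0..1}\<close> constantly.\<close>
  define g0 where "g0 = Bcontfun (\<lambda>t. a + clip t *\<^sub>R (b - a))"
  have "(\<lambda>t. a + clip t *\<^sub>R (b - a)) \<in> bcontfun"
  proof (rule bcontfun_normI)
    show "continuous_on UNIV (\<lambda>t. a + clip t *\<^sub>R (b - a))" by (intro continuous_intros clip)
    fix t
    have "norm (a + clip t *\<^sub>R (b - a)) \<le> norm a + clip t * norm (b - a)"
      using norm_triangle_ineq[of a "clip t *\<^sub>R (b - a)"] clip(2)[of t] by simp
    also have "\<dots> \<le> norm a + 1 * norm (b - a)"
      using clip(2)[of t] by (intro add_left_mono mult_right_mono) auto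
    finally show "norm (a + clip t *\<^sub>R (b - a)) \<le> norm a + 1 * norm (b - a)" .
  qed
  then have g0: "g0 \<in> P" using clip(3) by (simp add: P_def g0_def Bcontfun_inverse)
  show ?thesis
  proof (rule that[of "peak g0"])
    fix \<epsilon> :: real assume \<epsilon>: "\<epsilon> > 0"
    have "bdd_below (peak ` P)" using peak_ge by (auto intro!: bdd_belowI2[of _ \<kappa>])
    then obtain g where g: "g \<in> P" "peak g \<le> peak g0" "\<And>k. k \<in> P \<Longrightarrow> peak g \<le> peak k + \<epsilon> * dist k g"
      using ekeland_variational_principle[OF closed_P g0 _ lsc \<epsilon>] by blast
    have "\<exists>t\<in>{0..1}. J (apply_bcontfun g t) = peak g \<and> norm (D (apply_bcontfun g t)) \<le> \<epsilon>"
    proof (rule ccontr)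
      assume neg: "\<not> ?thesis"
      define V where "V t = {x. norm x \<le> 1 \<and> (t \<in> {0, 1} \<longrightarrow> x = 0) \<and>
        (J (apply_bcontfun g t) = peak g \<longrightarrow> \<epsilon> < blinfun_apply (D (apply_bcontfun g t)) x)}" for t
      obtain v where v: "continuous_on {0..1} v" "\<And>t. t \<in> {0..1} \<Longrightarrow> v t \<in> V t"
      proof (rule continuous_selection_of_convex_sets[of "{0..1::real}" V])
        fix t :: real assume t: "t \<in> {0..1}"
        have "V t = cball 0 1 \<inter> (if t \<in> {0, 1} then {0} else UNIV) \<inter>
            (if J (apply_bcontfun g t) = peak g then {x. \<epsilon> < blinfun_apply (D (apply_bcontfun g t)) x} else UNIV)"
          by (auto simp: V_def)
        moreover have "convex {x. \<epsilon> < blinfun_apply (D (apply_bcontfun g t)) x}"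
          using convex_linear_vimage[OF _ convex_real_interval(3), of "blinfun_apply (D (apply_bcontfun g t))" \<epsilon>]
          by (simp add: vimage_def greaterThan_def blinfun.bounded_linear_right bounded_linear.linear)
        ultimately show "convex (V t)" by (auto intro!: convex_Int)
        show "\<exists>x U. open U \<and> t \<in> U \<and> (\<forall>r\<in>U \<inter> {0..1}. x \<in> V r)"
        proof (cases "J (apply_bcontfun g t) = peak g")
          case False
          have "open {r. J (apply_bcontfun g r) \<noteq> peak g}"
            by (intro open_Collect_neq continuous_on_compose2[OF J] continuous_intros) auto
          then show ?thesis
            using False by (intro exI[of _ 0] exI[of _ "{r. J (apply_bcontfun g r) \<noteq> peak g}"]) (auto simp: V_def)
        next
          case True
          \<comment> \<open>The endpoints lie below the level \<open>\<kappa>\<close>, so the direction may vanish there.\<close>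
          have t01: "t \<notin> {0, 1}"
            using True g(1) ab peak_ge[OF g(1)] by (auto simp: P_def)
          have "\<epsilon> < norm (D (apply_bcontfun g t))" using neg True t by force
          then obtain x where x: "norm x \<le> 1" "\<epsilon> < blinfun_apply (D (apply_bcontfun g t)) x"
            using norm_blinfun_less_witness[of \<epsilon> "D (apply_bcontfun g t)"] \<epsilon> by (metis less_imp_le)
          define U where "U = {r. \<epsilon> < blinfun_apply (D (apply_bcontfun g r)) x} - {0, 1}"
          have "continuous_on UNIV (\<lambda>r. D (apply_bcontfun g r))"
            by (rule continuous_on_compose2[OF D]) auto
          then have "open {r. \<epsilon> < blinfun_apply (D (apply_bcontfun g r)) x}"
            by (intro open_Collect_less continuous_intros)
          then have "open U" unfolding U_def by (intro open_Diff) auto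
          then show ?thesis
            using x t01 by (intro exI[of _ x] exI[of _ U]) (auto simp: V_def U_def)
        qed
      qed auto
      have v_norm: "norm (v (clip t)) \<le> 1" for t
        using v(2)[OF clip(2)[of t]] by (simp add: V_def)
      define w where "w = Bcontfun (\<lambda>t. v (clip t))"
      have "(\<lambda>t. v (clip t)) \<in> bcontfun"
        using v_norm clip by (intro bcontfun_normI[of _ 1] continuous_on_compose2[OF v(1)]) auto
      then have w: "apply_bcontfun w t = v (clip t)" for t by (simp add: w_def Bcontfun_inverse)
      have push: "\<exists>t\<in>{0..1}. peak g \<le> J (apply_bcontfun g t - s *\<^sub>R v t) + \<epsilon> * s" if s: "0 < s" for s
      proof -
        define k where "k = g - s *\<^sub>R w"
        have k: "apply_bcontfun k t = apply_bcontfun g t - s *\<^sub>R v (clip t)" for t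
          by (simp add: k_def w)
        have "v 0 = 0" "v 1 = 0" using v(2)[of 0] v(2)[of 1] by (auto simp: V_def)
        then have "k \<in> P" using g(1) clip(3) by (simp add: P_def k)
        then have "peak g \<le> peak k + \<epsilon> * dist k g" by (rule g(3))
        also have "dist k g \<le> s"
        proof (rule dist_bound)
          fix t
          show "dist (apply_bcontfun k t) (apply_bcontfun g t) \<le> s"
            using s v_norm[of t] by (simp add: k dist_norm mult_left_le)
        qed
        then have "peak k + \<epsilon> * dist k g \<le> peak k + \<epsilon> * s" using \<epsilon> by simp
        finally have *: "peak g \<le> peak k + \<epsilon> * s" .
        obtain t where "t \<in> {0..1}" "J (apply_bcontfun k t) = peak k" using attained by blast
        then show ?thesis using * clip(3)[of t] by (intro bexI[of _ t]) (auto simp: k)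
      qed
      obtain t where t: "t \<in> {0..1}" "J (apply_bcontfun g t) = peak g"
          "blinfun_apply (D (apply_bcontfun g t)) (v t) \<le> \<epsilon>"
        by (rule peak_slope_le[OF deriv D compact_Icc continuous_on_apply_bcontfun v(1) le_peak push])
      then show False using v(2)[OF t(1)] by (simp add: V_def)
    qed
    then show "\<exists>x. \<kappa> \<le> J x \<and> J x \<le> peak g0 \<and> norm (D x) \<le> \<epsilon>"
      using peak_ge[OF g(1)] g(2) by metis
  qed
qed

text \<open>Every path from \<open>a\<close> to \<open>b\<close> meets the sphere.  The points found for \<open>\<epsilon> = 1/(n+1)\<close> form a
  Palais--Smale sequence with values in \<open>[\<kappa>, L]\<close>, and the limit of a subsequence is critical.\<close>
theorem mountain_pass:
  fixes J :: "'a::banach \<Rightarrow> real" and D :: "'a \<Rightarrow> 'a \<Rightarrow>\<^sub>L real"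
  assumes deriv: "\<And>x. (J has_derivative blinfun_apply (D x)) (at x)"
    and D: "continuous_on UNIV D" and PS: "palais_smale J"
    and ab: "J a < \<kappa>" "J b < \<kappa>" "norm a < r" "r < norm b"
    and sphere: "\<And>x. norm x = r \<Longrightarrow> \<kappa> \<le> J x"
  obtains z where "critical_point J z" "\<kappa> \<le> J z"
proof -
  have "\<exists>t\<in>{0..1::real}. \<kappa> \<le> J (g t)" if g: "continuous_on {0..1} g" "g 0 = a" "g 1 = b" for g
  proof -
    have "\<exists>t\<ge>0. t \<le> 1 \<and> norm (g t) = r"
      using g ab by (intro IVT' continuous_intros) auto
    then obtain t where "t \<in> {0..1}" "norm (g t) = r" by auto
    then show ?thesis using sphere[of "g t"] by blast
  qed
  from mountain_pass_almost_critical[OF deriv D ab(1,2) this] obtain L where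
    L: "\<And>\<epsilon>. \<epsilon> > 0 \<Longrightarrow> \<exists>x. \<kappa> \<le> J x \<and> J x \<le> L \<and> norm (D x) \<le> \<epsilon>" by blast
  have "\<forall>n. \<exists>x. \<kappa> \<le> J x \<and> J x \<le> L \<and> norm (D x) \<le> inverse (real (Suc n))"
    using L by simp
  from choice[OF this] obtain x where
    x: "\<And>n. \<kappa> \<le> J (x n)" "\<And>n. J (x n) \<le> L" "\<And>n. norm (D (x n)) \<le> inverse (real (Suc n))"
    by blast
  have Dx: "(\<lambda>n. D (x n)) \<longlonglongrightarrow> 0"
    by (rule Lim_null_comparison[OF _ LIMSEQ_inverse_real_of_nat]) (use x(3) in auto)
  have "bounded (range (\<lambda>n. J (x n)))"
    using x(1,2) by (intro bounded_subset[OF bounded_closed_interval[of \<kappa> L]]) auto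
  then obtain r z where r: "strict_mono r" "(x \<circ> r) \<longlonglongrightarrow> z"
    using PS[unfolded palais_smale_def, THEN spec[of _ x], THEN spec[of _ "\<lambda>n. D (x n)"]] deriv Dx
    by auto
  have lim: "(\<lambda>n. x (r n)) \<longlonglongrightarrow> z" using r(2) by (simp add: o_def)
  have "(\<lambda>n. D (x (r n))) \<longlonglongrightarrow> D z"
    using continuous_on_tendsto_compose[OF D lim] by simp
  moreover have "(\<lambda>n. D (x (r n))) \<longlonglongrightarrow> 0"
    using LIMSEQ_subseq_LIMSEQ[OF Dx r(1)] by (simp add: o_def)
  ultimately have "D z = 0" by (rule LIMSEQ_unique)
  then have "critical_point J z" using deriv[of z] by (simp add: critical_point_def zero_blinfun.rep_eq)
  moreover have "\<kappa> \<le> J z"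
  proof (rule tendsto_lowerbound)
    show "(\<lambda>n. J (x (r n))) \<longlonglongrightarrow> J z"
      using isCont_tendsto_compose[OF has_derivative_continuous[OF deriv] lim] .
  qed (use x(1) in auto)
  ultimately show ?thesis by (rule that)
qed

section \<open>Small minimizers and a second critical point\<close>

lemma ball_minimizer_iff:
  "ball_minimizer J \<rho> u \<longleftrightarrow> u \<in> cball 0 \<rho> \<and> (\<forall>x\<in>cball 0 \<rho>. J u \<le> J x)"
proof -
  have "ereal (J u) = (INF x\<in>cball 0 \<rho>. ereal (J x)) \<longleftrightarrow> (\<forall>x\<in>cball 0 \<rho>. J u \<le> J x)"
    if u: "u \<in> cball 0 \<rho>"
  proof
    assume "ereal (J u) = (INF x\<in>cball 0 \<rho>. ereal (J x))"
    then have "ereal (J u) \<le> ereal (J x)" if "x \<in> cball 0 \<rho>" for x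
      using INF_lower[OF that, of "\<lambda>x. ereal (J x)"] by simp
    then show "\<forall>x\<in>cball 0 \<rho>. J u \<le> J x" by auto
  next
    assume "\<forall>x\<in>cball 0 \<rho>. J u \<le> J x"
    then show "ereal (J u) = (INF x\<in>cball 0 \<rho>. ereal (J x))"
      using u by (intro antisym INF_greatest INF_lower) auto
  qed
  then show ?thesis by (auto simp: ball_minimizer_def)
qed

theorem theorem3:
  fixes \<Phi> :: "'e::banach \<Rightarrow> real" and \<phi> :: "'e \<Rightarrow> 'e \<Rightarrow>\<^sub>L real"
    and H :: "'z::banach \<Rightarrow> real" and h :: "'z \<Rightarrow> 'z \<Rightarrow>\<^sub>L real"
    and i :: "'e \<Rightarrow> 'z"
    and J :: "real \<Rightarrow> 'e \<Rightarrow> real"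
    and \<alpha> \<gamma> \<rho> :: real
  assumes "infinite_dimensional TYPE('e)"
    and "reflexive_space TYPE('e)"
    and "reflexive_space TYPE('z)"
    and "compact_embedding i"
    and "convex_on UNIV \<Phi>"
    and "\<And>v. (\<Phi> has_derivative blinfun_apply (\<phi> v)) (at v)"
    and "convex_on UNIV H"
    and "\<And>y. (H has_derivative blinfun_apply (h y)) (at y)"
    and "\<alpha> > 1" and "\<gamma> > 0"
    and "\<And>v. \<gamma> * norm v powr \<alpha> \<le> blinfun_apply (\<phi> v) v"
    and "\<And>lam x. J lam x = \<Phi> x - lam * H (i x)"
    and "\<rho> > 0"
    and "bdd_above ((\<lambda>x. norm (h (i x))) ` cball 0 \<rho>)"
  shows "\<exists>lamstar>0.
      (\<forall>lam\<in>{0<..lamstar}. \<exists>u.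
          ball_minimizer (J lam) \<rho> u \<and>
          critical_point (J lam) u \<and>
          (\<forall>x. blinfun_apply (\<phi> u) x = lam * blinfun_apply (h (i u)) (i x)) \<and>
          ((\<exists>v\<in>cball 0 \<rho>. J lam v < 0) \<and> J lam 0 = 0 \<longrightarrow> u \<noteq> 0)) \<and>
      (\<forall>u :: real \<Rightarrow> 'e.
          (\<forall>lam\<in>{0<..lamstar}.
              ball_minimizer (J lam) \<rho> (u lam) \<and> critical_point (J lam) (u lam)) \<and>
          (\<forall>lam\<in>{0<..lamstar}.
              palais_smale (J lam) \<and>
              (\<exists>\<rho>1 > norm (u lam). ereal (J lam (u lam)) < (INF x\<in>sphere 0 \<rho>1. ereal (J lam x))) \<and>
              (\<exists>w. filterlim (\<lambda>t. J lam (t *\<^sub>R w)) at_bot at_top))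
          \<longrightarrow>
          (\<forall>lam\<in>{0<..lamstar}.
              critical_point (J lam) (u lam) \<and>
              (\<exists>z. critical_point (J lam) z \<and> z \<noteq> 0 \<and> z \<noteq> u lam)))"
proof -
  note refl = assms(2) and emb = assms(4) and \<Phi> = assms(5,6) and H = assms(7,8)
    and \<gamma> = assms(10,11) and J_def = assms(12) and \<rho> = assms(13)
  have bl: "bounded_linear i" using emb by (simp add: compact_embedding_def)
  have i0: "i 0 = 0" using bl by (simp add: linear_simps)
  obtain C where C: "C > 0" "\<And>x. norm (i x) \<le> norm x * C"
    using bounded_linear.pos_bounded[OF bl] by blast
  obtain M where M: "\<And>x. x \<in> cball 0 \<rho> \<Longrightarrow> norm (h (i x)) \<le> M"
    using assms(14) unfolding bdd_above_def by blast
  have M0: "0 \<le> M" using \<rho> by (intro order_trans[OF norm_ge_zero M[of 0]]) simp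
  define c where "c = \<gamma> * (\<rho> / 2) powr \<alpha>"
  have c: "c > 0" using \<gamma>(1) \<rho> by (simp add: c_def)
  define K where "K = M * (\<rho> * C)"
  have K: "K \<ge> 0" using M0 \<rho> C(1) by (simp add: K_def)
  \<comment> \<open>Half of the growth \<open>c\<close> of \<open>\<Phi>\<close> is left for \<open>lam * K\<close>; \<open>K + 1\<close> is used because \<open>K\<close> may be \<open>0\<close>.\<close>
  define lamstar where "lamstar = c / (2 * (K + 1))"
  have lamstar: "lamstar > 0" using c K by (simp add: lamstar_def)
  have H_le: "H (i x) \<le> H 0 + K" if x: "x \<in> cball 0 \<rho>" for x
  proof -
    have "blinfun_apply (h (i x)) (i x) \<le> norm (h (i x)) * norm (i x)"
      using norm_blinfun[of "h (i x)" "i x"] by simp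
    also have "\<dots> \<le> M * (\<rho> * C)"
      using M[OF x] M0 x C order_trans[OF C(2)[of x], of "\<rho> * C"] by (intro mult_mono) auto
    finally show ?thesis
      using convex_above_tangent[OF H, of "i x" 0] by (simp add: K_def blinfun.minus_right)
  qed
  have lam_K: "lam * K \<le> c / 2" if "lam \<in> {0<..lamstar}" for lam
  proof -
    have "lam * K \<le> lamstar * (K + 1)" using that K by (intro mult_mono) auto
    also have "\<dots> = c / 2" using K by (simp add: lamstar_def field_simps)
    finally show ?thesis .
  qed
  have J_ge: "J lam 0 + \<gamma> * (norm x / 2) powr \<alpha> - c / 2 \<le> J lam x"
    if lam: "lam \<in> {0<..lamstar}" and x: "x \<in> cball 0 \<rho>" for lam x
  proof -
    have "lam * H (i x) \<le> lam * (H 0 + K)" using H_le[OF x] lam by (intro mult_left_mono) auto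
    then show ?thesis
      using lam_K[OF lam] convex_coercive_growth[OF \<Phi> less_imp_le[OF \<gamma>(1)] \<gamma>(2), of x]
      by (simp add: J_def i0 distrib_left)
  qed
  have J_lower: "J lam 0 - c / 2 \<le> J lam x"
    if "lam \<in> {0<..lamstar}" "x \<in> cball 0 \<rho>" for lam x
  proof -
    have "0 \<le> \<gamma> * (norm x / 2) powr \<alpha>" using \<gamma>(1) by simp
    then show ?thesis using J_ge[OF that] by linarith
  qed
  have J_sphere: "J lam 0 + c / 2 \<le> J lam x" if "lam \<in> {0<..lamstar}" "norm x = \<rho>" for lam x
    using J_ge[OF that(1), of x] that(2) by (simp add: c_def)
  define D where "D lam x = \<phi> x - lam *\<^sub>R (h (i x) o\<^sub>L Blinfun i)" for lam x
  have D: "(J lam has_derivative blinfun_apply (D lam x)) (at x)" for lam x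
  proof -
    have "((\<lambda>x. H (i x)) has_derivative (\<lambda>k. blinfun_apply (h (i x)) (i k))) (at x)"
      by (rule has_derivative_compose[OF bounded_linear_imp_has_derivative[OF bl] H(2)])
    then have "((\<lambda>x. \<Phi> x - lam * H (i x)) has_derivative
        (\<lambda>k. blinfun_apply (\<phi> x) k - lam * blinfun_apply (h (i x)) (i k))) (at x)"
      by (intro has_derivative_diff \<Phi>(2) has_derivative_mult_right)
    moreover have "J lam = (\<lambda>x. \<Phi> x - lam * H (i x))" by (simp add: J_def fun_eq_iff)
    moreover have "blinfun_apply (D lam x) = (\<lambda>k. blinfun_apply (\<phi> x) k - lam * blinfun_apply (h (i x)) (i k))"
      by (simp add: D_def fun_eq_iff blinfun.diff_left blinfun.scaleR_left bounded_linear_Blinfun_apply[OF bl])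
    ultimately show ?thesis by simp
  qed
  have cont_D: "continuous_on UNIV (D lam)" for lam
    unfolding D_def[abs_def]
    by (intro continuous_intros convex_has_derivative_continuous[OF \<Phi>]
        continuous_on_compose2[OF convex_has_derivative_continuous[OF H]]
        linear_continuous_on[OF bl]) auto
  have i: "\<exists>u. ball_minimizer (J lam) \<rho> u \<and> critical_point (J lam) u \<and>
      (\<forall>x. blinfun_apply (\<phi> u) x = lam * blinfun_apply (h (i u)) (i x)) \<and>
      ((\<exists>v\<in>cball 0 \<rho>. J lam v < 0) \<and> J lam 0 = 0 \<longrightarrow> u \<noteq> 0)"
    if lam: "lam \<in> {0<..lamstar}" for lam
  proof -
    have cont: "continuous_on UNIV \<Phi>" "continuous_on UNIV H"
      using has_derivative_continuous[OF \<Phi>(2)] has_derivative_continuous[OF H(2)]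
      by (simp_all add: continuous_at_imp_continuous_on)
    have "continuous_on UNIV (\<lambda>z. - lam * H z)" by (intro continuous_intros cont)
    moreover have "bdd_below ((\<lambda>x. \<Phi> x + - lam * H (i x)) ` cball 0 \<rho>)"
      using J_lower[OF lam] by (intro bdd_belowI2[of _ "J lam 0 - c / 2"]) (simp add: J_def)
    ultimately obtain u where u: "u \<in> cball 0 \<rho>"
        "\<And>x. x \<in> cball 0 \<rho> \<Longrightarrow> \<Phi> u + - lam * H (i u) \<le> \<Phi> x + - lam * H (i x)"
      using convex_plus_compact_attains_min[OF refl emb \<Phi>(1) cont(1), of "\<lambda>z. - lam * H z" "cball 0 \<rho>"] \<rho>
      by auto
    then have min: "J lam u \<le> J lam x" if "x \<in> cball 0 \<rho>" for x
      using that by (simp add: J_def)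
    have "norm u \<noteq> \<rho>"
      using min[of 0] J_sphere[OF lam, of u] c \<rho> by auto
    then have "norm u < \<rho>" using u(1) by simp
    then have "blinfun_apply (D lam u) = (\<lambda>_. 0)"
      using min by (intro differential_zero_maxmin[of u "ball 0 \<rho>" "J lam"] D) auto
    moreover from this have "critical_point (J lam) u"
      using D[of lam u] by (simp add: critical_point_def)
    moreover have "blinfun_apply (D lam u) x = blinfun_apply (\<phi> u) x - lam * blinfun_apply (h (i u)) (i x)" for x
      by (simp add: D_def blinfun.diff_left blinfun.scaleR_left bounded_linear_Blinfun_apply[OF bl])
    ultimately show ?thesis
      using u(1) min by (intro exI[of _ u]) (fastforce simp: ball_minimizer_iff)
  qed
  have ii: "\<exists>z. critical_point (J lam) z \<and> z \<noteq> 0 \<and> z \<noteq> u"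
    if lam: "lam \<in> {0<..lamstar}" and u: "ball_minimizer (J lam) \<rho> u" and PS: "palais_smale (J lam)"
      and w: "filterlim (\<lambda>t. J lam (t *\<^sub>R w)) at_bot at_top" for lam u w
  proof -
    have "\<forall>\<^sub>F t in at_top. J lam (t *\<^sub>R w) < J lam 0 - c / 2"
      using w by (simp add: filterlim_at_bot_dense)
    then obtain t where t: "J lam (t *\<^sub>R w) < J lam 0 - c / 2"
      by (auto dest: eventually_happens)
    \<comment> \<open>The ray is too low at this point to be still inside the ball, where \<open>J\<close> is at least \<open>J 0 - c / 2\<close>.\<close>
    have far: "\<rho> < norm (t *\<^sub>R w)"
    proof (rule ccontr)
      assume "\<not> ?thesis"
      then show False using J_lower[OF lam, of "t *\<^sub>R w"] t by simp
    qed
    obtain z where z: "critical_point (J lam) z" "J lam 0 + c / 2 \<le> J lam z"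
      using mountain_pass[OF D cont_D PS, of 0 "J lam 0 + c / 2" "t *\<^sub>R w" \<rho>]
        t far c \<rho> J_sphere[OF lam] by auto
    have "J lam u \<le> J lam 0" using u \<rho> by (simp add: ball_minimizer_iff)
    then show ?thesis using z c by (intro exI[of _ z]) auto
  qed
  show ?thesis
  proof (intro exI[of _ lamstar] conjI ballI allI impI)
    fix lam assume "lam \<in> {0<..lamstar}"
    then show "\<exists>u. ball_minimizer (J lam) \<rho> u \<and> critical_point (J lam) u \<and>
        (\<forall>x. blinfun_apply (\<phi> u) x = lam * blinfun_apply (h (i u)) (i x)) \<and>
        ((\<exists>v\<in>cball 0 \<rho>. J lam v < 0) \<and> J lam 0 = 0 \<longrightarrow> u \<noteq> 0)" by (rule i)
  next
    fix u :: "real \<Rightarrow> 'e" and lam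
    assume "(\<forall>lam\<in>{0<..lamstar}.
              ball_minimizer (J lam) \<rho> (u lam) \<and> critical_point (J lam) (u lam)) \<and>
          (\<forall>lam\<in>{0<..lamstar}.
              palais_smale (J lam) \<and>
              (\<exists>\<rho>1 > norm (u lam). ereal (J lam (u lam)) < (INF x\<in>sphere 0 \<rho>1. ereal (J lam x))) \<and>
              (\<exists>w. filterlim (\<lambda>t. J lam (t *\<^sub>R w)) at_bot at_top))"
      and lam: "lam \<in> {0<..lamstar}"
    then have u: "ball_minimizer (J lam) \<rho> (u lam)" "critical_point (J lam) (u lam)"
      and PS: "palais_smale (J lam)"
      and w: "\<exists>w. filterlim (\<lambda>t. J lam (t *\<^sub>R w)) at_bot at_top"
      by blast+
    show "critical_point (J lam) (u lam)" by (rule u(2))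
    show "\<exists>z. critical_point (J lam) z \<and> z \<noteq> 0 \<and> z \<noteq> u lam"
      using w ii[OF lam u(1) PS] by blast
  qed (rule lamstar)
qed

end
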